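(* Let $G=(V,E)$ be a finite or locally finite connected weighted graph with symmetric edge weights $\omega$ and vertex measure $\mu$ such that $D_\mu<\infty$, let $p(t,x,y)$ be its heat kernel, and let $\Lambda\ge 0$ be the bottom of the $\ell^2(V,\mu)$ spectrum of $-\Delta$. If $x_1,x_2\in V$, then for all $t>0$, $$p(t,x_1,x_2)\leq \big(\mu(x_1)\mu(x_2)\big)^{-\frac12}\exp\left(-\frac{d(x_1,x_2)}{2}\log\left(\frac{d(x_1,x_2)}{2D_\mu e t}\right)-\Lambda t\right),$$ where $d$ is the natural graph metric and the term $\frac{d(x_1,x_2)}{2}\log\left(\frac{d(x_1,x_2)}{2D_\mu e t}\right)$ is read as $0$ when $d(x_1,x_2)=0$.
   Context: $G=(V,E)$ is a finite or locally finite connected graph; $y\sim x$ means $\overline{xy}\in E$. Weights are given by $\omega:V\times V\to[0,\infty)$ with $\omega_{xy}=\omega_{yx}$, where $\omega_{xy}$ is the weight of the edge $\overline{xy}$. The measure is a function $\mu:V\to\mathbb{R}^+$ (positive and finite at each vertex). Put $m(x)=\sum_{y\sim x}\omega_{xy}$ and $D_\mu=\sup_{x\in V} m(x)/\mu(x)$; it is assumed throughout that $D_\mu<\infty$. $\ell^2(V,\mu)$ is the Hilbert space of real functions $f$ on $V$ with $\sum_{x}\mu(x)|f(x)|^2<\infty$, with inner product $\langle f,g\rangle=\sum_x\mu(x)f(x)g(x)$. The $\mu$-Laplacian is $\Delta f(x)=\frac{1}{\mu(x)}\sum_{y\sim x}\omega_{xy}(f(y)-f(x))$; since $D_\mu<\infty$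 it is bounded on $\ell^p(V,\mu)$ for all $p\in[1,\infty]$. The natural graph metric $d(x,y)$ is the smallest number of edges of a path between $x$ and $y$. Heat kernel: for a finite subset $U\subset V$, let $p_U(t,x,y)$ be the (Dirichlet) heat kernel on $U$ with respect to $\mu$, i.e. $p_U(t,x,y)=\frac{1}{\mu(y)}(e^{t\Delta_U}\mathbf 1_{\{y\}})(x)$ for $x,y\in U$, where $\Delta_U f=(\Delta f)|_U$ for functions $f$ on $U$ extended by $0$ outside $U$; and $p_U(t,x,y)=0$ if $x\notin U$ or $y\notin U$. For an exhaustion $U_1\subset U_2\subset\cdots$ of $V$ by finite subsets with $\bigcup_k U_k=V$, the heat kernel on $G$ is $p(t,x,y)=\lim_{k\to\infty}p_{U_k}(t,x,y)$; the sequence is nondecreasing in $k$ and the limit does not depend on the exhaustion. *)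

theory Defs
  imports "HOL-Analysis.Analysis"
begin

(* The vertex set V is the universe of the (arbitrary) type 'v.  E is the symmetric adjacency
   relation; values of the weight off E are never used.  Zero weights on edges and loops are
   not excluded. *)
locale weighted_graph =
  fixes E :: "'v rel"
    and \<omega> :: "'v \<Rightarrow> 'v \<Rightarrow> real"
    and \<mu> :: "'v \<Rightarrow> real"
  assumes sym_edges: "sym E"
    and locally_finite: "\<And>x. finite {y. (x, y) \<in> E}"
    and connected: "\<And>x y. (x, y) \<in> E\<^sup>*"
    and weight_nonneg: "\<And>x y. 0 \<le> \<omega> x y"
    and weight_sym: "\<And>x y. \<omega> x y = \<omega> y x"
    and measure_pos: "\<And>x. 0 < \<mu> x"

definition weighted_degree :: "'v rel \<Rightarrow> ('v \<Rightarrow> 'v \<Rightarrow> real) \<Rightarrow> 'v \<Rightarrow> real" where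
  "weighted_degree E \<omega> x = (\<Sum>y | (x, y) \<in> E. \<omega> x y)"

definition finite_D :: "'v rel \<Rightarrow> ('v \<Rightarrow> 'v \<Rightarrow> real) \<Rightarrow> ('v \<Rightarrow> real) \<Rightarrow> bool" where
  "finite_D E \<omega> \<mu> \<longleftrightarrow> bdd_above (range (\<lambda>x. weighted_degree E \<omega> x / \<mu> x))"

(* The supremum is meaningful only under finite_D. *)
definition D_sup :: "'v rel \<Rightarrow> ('v \<Rightarrow> 'v \<Rightarrow> real) \<Rightarrow> ('v \<Rightarrow> real) \<Rightarrow> real" where
  "D_sup E \<omega> \<mu> = (SUP x. weighted_degree E \<omega> x / \<mu> x)"

definition laplacian ::
    "'v rel \<Rightarrow> ('v \<Rightarrow> 'v \<Rightarrow> real) \<Rightarrow> ('v \<Rightarrow> real) \<Rightarrow> ('v \<Rightarrow> real) \<Rightarrow> 'v \<Rightarrow> real" where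
  "laplacian E \<omega> \<mu> f x = 1 / \<mu> x * (\<Sum>y | (x, y) \<in> E. \<omega> x y * (f y - f x))"

(* E ^^ n relates the two ends of a walk with n edges. *)
definition graph_dist :: "'v rel \<Rightarrow> 'v \<Rightarrow> 'v \<Rightarrow> nat" where
  "graph_dist E x y = (LEAST n. (x, y) \<in> E ^^ n)"

definition ell2 :: "('v \<Rightarrow> real) \<Rightarrow> ('v \<Rightarrow> real) set" where
  "ell2 \<mu> = {f. (\<lambda>x. \<mu> x * (f x)\<^sup>2) summable_on UNIV}"

definition ell2_norm :: "('v \<Rightarrow> real) \<Rightarrow> ('v \<Rightarrow> real) \<Rightarrow> real" where
  "ell2_norm \<mu> f = sqrt (\<Sum>\<^sub>\<infinity>x. \<mu> x * (f x)\<^sup>2)"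

definition ell2_bounded_operator ::
    "('v \<Rightarrow> real) \<Rightarrow> (('v \<Rightarrow> real) \<Rightarrow> 'v \<Rightarrow> real) \<Rightarrow> bool" where
  "ell2_bounded_operator \<mu> T \<longleftrightarrow>
     (\<forall>f\<in>ell2 \<mu>. T f \<in> ell2 \<mu>) \<and>
     (\<forall>f\<in>ell2 \<mu>. \<forall>g\<in>ell2 \<mu>. T (\<lambda>x. f x + g x) = (\<lambda>x. T f x + T g x)) \<and>
     (\<forall>f\<in>ell2 \<mu>. \<forall>c. T (\<lambda>x. c * f x) = (\<lambda>x. c * T f x)) \<and>
     (\<exists>C. \<forall>f\<in>ell2 \<mu>. ell2_norm \<mu> (T f) \<le> C * ell2_norm \<mu> f)"

(* Real spectrum: all c such that T - c has no bounded two-sided inverse on ell2.  For a bounded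
   self-adjoint T this is the whole spectrum of its complexification. *)
definition ell2_spectrum ::
    "('v \<Rightarrow> real) \<Rightarrow> (('v \<Rightarrow> real) \<Rightarrow> 'v \<Rightarrow> real) \<Rightarrow> real set" where
  "ell2_spectrum \<mu> T = {c. \<not> (\<exists>R. ell2_bounded_operator \<mu> R \<and>
     (\<forall>f\<in>ell2 \<mu>. R (\<lambda>x. T f x - c * f x) = f \<and>
                 (\<lambda>x. T (R f) x - c * R f x) = f))}"

definition spectral_bottom ::
    "'v rel \<Rightarrow> ('v \<Rightarrow> 'v \<Rightarrow> real) \<Rightarrow> ('v \<Rightarrow> real) \<Rightarrow> real" where
  "spectral_bottom E \<omega> \<mu> = Inf (ell2_spectrum \<mu> (\<lambda>f x. - laplacian E \<omega> \<mu> f x))"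

(* Functions on U are represented by functions on all of V vanishing outside U. *)
definition dirichlet_laplacian ::
    "'v rel \<Rightarrow> ('v \<Rightarrow> 'v \<Rightarrow> real) \<Rightarrow> ('v \<Rightarrow> real) \<Rightarrow> 'v set \<Rightarrow> ('v \<Rightarrow> real) \<Rightarrow> 'v \<Rightarrow> real" where
  "dirichlet_laplacian E \<omega> \<mu> U f x =
     (if x \<in> U then laplacian E \<omega> \<mu> (\<lambda>z. if z \<in> U then f z else 0) x else 0)"

(* The exponential series of t times the Dirichlet Laplacian, evaluated coordinatewise; for finite U
   the function space is finite-dimensional, so this is convergence in norm. *)
definition dirichlet_semigroup ::
    "'v rel \<Rightarrow> ('v \<Rightarrow> 'v \<Rightarrow> real) \<Rightarrow> ('v \<Rightarrow> real) \<Rightarrow> 'v set \<Rightarrow> real \<Rightarrow> ('v \<Rightarrow> real) \<Rightarrow> 'v \<Rightarrow> real" where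
  "dirichlet_semigroup E \<omega> \<mu> U t f x =
     (\<Sum>n. t ^ n / fact n * (dirichlet_laplacian E \<omega> \<mu> U ^^ n) f x)"

definition dirichlet_heat_kernel ::
    "'v rel \<Rightarrow> ('v \<Rightarrow> 'v \<Rightarrow> real) \<Rightarrow> ('v \<Rightarrow> real) \<Rightarrow> 'v set \<Rightarrow> real \<Rightarrow> 'v \<Rightarrow> 'v \<Rightarrow> real" where
  "dirichlet_heat_kernel E \<omega> \<mu> U t x y =
     (if x \<in> U \<and> y \<in> U
      then 1 / \<mu> y * dirichlet_semigroup E \<omega> \<mu> U t (indicator {y}) x else 0)"

definition exhaustion :: "(nat \<Rightarrow> 'v set) \<Rightarrow> bool" where
  "exhaustion U \<longleftrightarrow> (\<forall>k. finite (U k)) \<and> (\<forall>k. U k \<subseteq> U (Suc k)) \<and> (\<Union>k. U k) = UNIV"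

(* The common limit along all exhaustions; exhaustions exist because a connected locally finite
   graph is countable. *)
definition heat_kernel ::
    "'v rel \<Rightarrow> ('v \<Rightarrow> 'v \<Rightarrow> real) \<Rightarrow> ('v \<Rightarrow> real) \<Rightarrow> real \<Rightarrow> 'v \<Rightarrow> 'v \<Rightarrow> real" where
  "heat_kernel E \<omega> \<mu> t x y =
     (THE l. \<forall>U. exhaustion U \<longrightarrow>
        (\<lambda>k. dirichlet_heat_kernel E \<omega> \<mu> (U k) t x y) \<longlonglongrightarrow> l)"

end

theory Submission
  imports Defs
begin

text \<open>
  The proof is Davies' method of exponential perturbation, carried out on a finite set \<open>U\<close> of
  vertices. Let \<open>u\<close> be the Dirichlet heat flow on \<open>U\<close> started at \<open>y\<close>, and let \<open>\<psi>\<close> be \<open>a \<ge> 0\<close> times the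
  distance to \<open>y\<close>. The weighted energy \<open>\<Sum> \<mu> (exp \<psi> u)\<^sup>2\<close> has a derivative governed by the form of
  the conjugated Laplacian. In it, each edge carries the factor \<open>cosh (\<psi> x - \<psi> y) \<le> cosh a\<close> in
  place of 1, so that the energy grows at most at the rate \<open>2 ((cosh a - 1) D - \<Lambda>)\<close>
  (\<open>weighted_energy_decay\<close>). Reading off one term of the energy gives
  \<open>p\<^sub>U(t,x,y) \<le> (\<mu>(x) \<mu>(y)) powr (-1/2) * exp (-a d(x,y) + ((cosh a - 1) D - \<Lambda>) t)\<close>,
  and a near-optimal \<open>a\<close> (\<open>exponent_choice\<close>) yields the stated exponent.

  The rate involves \<open>\<Lambda>\<close> through \<open>\<Lambda> \<parallel>f\<parallel>\<^sup>2 \<le> \<langle>f, -\<Delta> f\<rangle>\<close> for finitely supported \<open>f\<close>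
  (\<open>spectral_bottom_le\<close>). Two facts about the spectrum give this: it is bounded below, since for
  \<open>c < 0\<close> the operator \<open>-\<Delta> - c\<close> is inverted by a Neumann series (\<open>not_in_spectrum\<close>); and it contains
  the infimum of the Rayleigh quotients (\<open>rayleigh_inf_in_spectrum\<close>), since a bounded inverse there
  would open a gap above that infimum.

  The bound passes to the graph because the Dirichlet kernels increase with \<open>U\<close>, so that all
  exhaustions have the same limit (\<open>heat_kernel_limit\<close>). Monotonicity is visible after the diagonal
  of the Laplacian is absorbed into a scalar factor: \<open>exp (t \<Delta>)\<close> is \<open>exp (-D t)\<close> times the exponential
  of a nonnegative kernel (\<open>dirichlet_semigroup_eq_jump\<close>).
\<close>

section \<open>Exponentials of finite kernels\<close>

definition kernel_op :: "'a set \<Rightarrow> ('a \<Rightarrow> 'a \<Rightarrow> real) \<Rightarrow> ('a \<Rightarrow> real) \<Rightarrow> 'a \<Rightarrow> real" where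
  "kernel_op U k f x = (\<Sum>y\<in>U. k x y * f y)"

definition kernel_exp ::
    "'a set \<Rightarrow> ('a \<Rightarrow> 'a \<Rightarrow> real) \<Rightarrow> real \<Rightarrow> ('a \<Rightarrow> real) \<Rightarrow> 'a \<Rightarrow> real" where
  "kernel_exp U k t f x = (\<Sum>n. t ^ n / fact n * (kernel_op U k ^^ n) f x)"

lemma kernel_op_power_bound:
  assumes "finite U" "x \<in> U"
  shows "\<bar>(kernel_op U k ^^ n) f x\<bar> \<le> (\<Sum>x\<in>U. \<Sum>y\<in>U. \<bar>k x y\<bar>) ^ n * (\<Sum>y\<in>U. \<bar>f y\<bar>)"
  using assms(2)
proof (induction n arbitrary: x)
  case 0
  then show ?case using assms(1) by (simp add: member_le_sum[of x U "\<lambda>y. \<bar>f y\<bar>"])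
next
  case (Suc n)
  let ?C = "\<Sum>x\<in>U. \<Sum>y\<in>U. \<bar>k x y\<bar>" and ?M = "\<Sum>y\<in>U. \<bar>f y\<bar>"
  have "\<bar>(kernel_op U k ^^ Suc n) f x\<bar> \<le> (\<Sum>y\<in>U. \<bar>k x y * (kernel_op U k ^^ n) f y\<bar>)"
    by (simp add: kernel_op_def)
  also have "\<dots> \<le> (\<Sum>y\<in>U. \<bar>k x y\<bar> * (?C ^ n * ?M))"
    unfolding abs_mult by (intro sum_mono mult_left_mono Suc.IH) auto
  also have "\<dots> = (\<Sum>y\<in>U. \<bar>k x y\<bar>) * (?C ^ n * ?M)"
    by (simp add: sum_distrib_right)
  also have "\<dots> \<le> ?C * (?C ^ n * ?M)"
    using assms(1) Suc.prems
    by (intro mult_right_mono member_le_sum[of x U "\<lambda>x. \<Sum>y\<in>U. \<bar>k x y\<bar>"])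
       (auto intro!: sum_nonneg mult_nonneg_nonneg zero_le_power)
  finally show ?case by (simp add: mult.assoc)
qed

lemma kernel_exp_summable:
  assumes "finite U" "x \<in> U"
  shows "summable (\<lambda>n. t ^ n / fact n * (kernel_op U k ^^ n) f x)"
proof -
  let ?C = "\<Sum>x\<in>U. \<Sum>y\<in>U. \<bar>k x y\<bar>" and ?M = "\<Sum>y\<in>U. \<bar>f y\<bar>"
  have "summable (\<lambda>n. (\<bar>t\<bar> * ?C) ^ n / fact n * ?M)"
    using summable_exp[of "\<bar>t\<bar> * ?C"] by (intro summable_mult2) (simp add: divide_inverse mult.commute)
  moreover have "norm (t ^ n / fact n * (kernel_op U k ^^ n) f x) \<le> (\<bar>t\<bar> * ?C) ^ n / fact n * ?M" for n
  proof -
    have "norm (t ^ n / fact n * (kernel_op U k ^^ n) f x)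
        = \<bar>t\<bar> ^ n / fact n * \<bar>(kernel_op U k ^^ n) f x\<bar>"
      by (simp add: abs_mult power_abs)
    also have "\<dots> \<le> \<bar>t\<bar> ^ n / fact n * (?C ^ n * ?M)"
      by (intro mult_left_mono kernel_op_power_bound assms) auto
    finally show ?thesis by (simp add: power_mult_distrib mult_ac)
  qed
  ultimately show ?thesis by (rule summable_comparison_test'[where N = 0])
qed

lemma kernel_exp_0: "kernel_exp U k 0 f x = f x"
  unfolding kernel_exp_def
  by (subst suminf_finite[where N = "{0}"]) auto

text \<open>
  Differentiating the power series termwise shifts its coefficients by one application of the
  kernel, and the finite sum over \<open>U\<close> commutes with the series. So the exponential solves the
  linear evolution equation of the kernel.
\<close>
lemma kernel_exp_has_derivative:
  assumes "finite U" "x \<in> U"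
  shows "((\<lambda>t. kernel_exp U k t f x) has_real_derivative
           kernel_op U k (kernel_exp U k t f) x) (at t)"
proof -
  define c where "c n = (kernel_op U k ^^ n) f x / fact n" for n
  have "summable (\<lambda>n. c n * s ^ n)" for s
    using kernel_exp_summable[OF assms, of s k f] by (simp add: c_def mult_ac)
  then have "((\<lambda>t. \<Sum>n. c n * t ^ n) has_real_derivative (\<Sum>n. diffs c n * t ^ n)) (at t)"
    by (rule termdiffs_strong_converges_everywhere)
  moreover have "(\<lambda>t. \<Sum>n. c n * t ^ n) = (\<lambda>t. kernel_exp U k t f x)"
    by (simp add: kernel_exp_def c_def mult_ac)
  moreover have "(\<Sum>n. diffs c n * t ^ n) = kernel_op U k (kernel_exp U k t f) x"
  proof -
    have "diffs c n * t ^ n = (\<Sum>y\<in>U. k x y * (t ^ n / fact n * (kernel_op U k ^^ n) f y))" for n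
    proof -
      have "diffs c n = kernel_op U k ((kernel_op U k ^^ n) f) x / fact n"
        by (simp add: diffs_def c_def field_simps del: of_nat_Suc)
      then show ?thesis
        by (simp add: kernel_op_def sum_distrib_left sum_distrib_right sum_divide_distrib mult_ac)
    qed
    then have "(\<Sum>n. diffs c n * t ^ n)
        = (\<Sum>y\<in>U. \<Sum>n. k x y * (t ^ n / fact n * (kernel_op U k ^^ n) f y))"
      by (simp only:) (intro suminf_sum summable_mult kernel_exp_summable assms(1))
    also have "\<dots> = kernel_op U k (kernel_exp U k t f) x"
      unfolding kernel_op_def[of U k "kernel_exp U k t f"] kernel_exp_def using assms(1)
      by (intro sum.cong suminf_mult kernel_exp_summable) auto
    finally show ?thesis .
  qed
  ultimately show ?thesis by simp
qed

lemma kernel_op_power_mono: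
  assumes "finite V" "U \<subseteq> V"
    and "\<And>x y. 0 \<le> j x y" "\<And>x y. j x y \<le> k x y" "\<And>x. 0 \<le> f x"
  shows "0 \<le> (kernel_op U j ^^ n) f x \<and> (kernel_op U j ^^ n) f x \<le> (kernel_op V k ^^ n) f x"
proof (induction n arbitrary: x)
  case 0
  then show ?case using assms(5) by simp
next
  case (Suc n)
  let ?J = "(kernel_op U j ^^ n) f" and ?K = "(kernel_op V k ^^ n) f"
  have k0: "0 \<le> k x y" for x y using assms(3,4)[of x y] by linarith
  have "(\<Sum>y\<in>U. j x y * ?J y) \<le> (\<Sum>y\<in>U. k x y * ?K y)"
    using Suc.IH assms(3,4) by (intro sum_mono mult_mono k0) auto
  also have "\<dots> \<le> (\<Sum>y\<in>V. k x y * ?K y)"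
    using assms(1,2) by (intro sum_mono2 mult_nonneg_nonneg k0 order_trans[OF conjunct1 conjunct2, OF Suc.IH Suc.IH])
  finally show ?case
    using Suc.IH assms(3)
    by (auto simp: kernel_op_def[of U j ?J x] kernel_op_def[of V k ?K x]
        intro!: sum_nonneg mult_nonneg_nonneg)
qed

text \<open>
  For nonnegative kernels, every term of the exponential series is a sum over paths with
  nonnegative weights, and enlarging the set or the kernel only adds to it.
\<close>
lemma kernel_exp_mono:
  assumes "finite V" "U \<subseteq> V" "x \<in> U" "0 \<le> t"
    and "\<And>x y. 0 \<le> j x y" "\<And>x y. j x y \<le> k x y" "\<And>x. 0 \<le> f x"
  shows "kernel_exp U j t f x \<le> kernel_exp V k t f x"
  unfolding kernel_exp_def
proof (rule suminf_le)
  show "t ^ n / fact n * (kernel_op U j ^^ n) f x \<le> t ^ n / fact n * (kernel_op V k ^^ n) f x" for n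
    using kernel_op_power_mono[where j = j and k = k, OF assms(1,2,5-7)] assms(4) by (intro mult_left_mono) auto
qed (use assms in \<open>auto intro!: kernel_exp_summable[simplified] intro: finite_subset\<close>)

lemma kernel_exp_nonneg:
  assumes "finite U" "x \<in> U" "0 \<le> t" and "\<And>x y. 0 \<le> k x y" "\<And>x. 0 \<le> f x"
  shows "0 \<le> kernel_exp U k t f x"
  unfolding kernel_exp_def
  using kernel_op_power_mono[where j = k and k = k and U = U and V = U and f = f] assms
  by (intro suminf_nonneg kernel_exp_summable mult_nonneg_nonneg) auto

section \<open>Edge sums and the Laplacian\<close>

lemma weighted_sum_square_le:
  fixes k f :: "'b \<Rightarrow> real"
  assumes "\<And>y. y \<in> A \<Longrightarrow> 0 \<le> k y"
  shows "(\<Sum>y\<in>A. k y * f y)\<^sup>2 \<le> (\<Sum>y\<in>A. k y) * (\<Sum>y\<in>A. k y * (f y)\<^sup>2)"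
proof -
  have "(\<Sum>y\<in>A. sqrt (k y) * (sqrt (k y) * f y))\<^sup>2
      \<le> (\<Sum>y\<in>A. (sqrt (k y))\<^sup>2) * (\<Sum>y\<in>A. (sqrt (k y) * f y)\<^sup>2)"
    by (rule Cauchy_Schwarz_ineq_sum)
  moreover have "(\<Sum>y\<in>A. sqrt (k y) * (sqrt (k y) * f y)) = (\<Sum>y\<in>A. k y * f y)"
    using assms by (intro sum.cong) (auto simp flip: mult.assoc)
  moreover have "(\<Sum>y\<in>A. (sqrt (k y))\<^sup>2) = (\<Sum>y\<in>A. k y)"
    using assms by (intro sum.cong) auto
  moreover have "(\<Sum>y\<in>A. (sqrt (k y) * f y)\<^sup>2) = (\<Sum>y\<in>A. k y * (f y)\<^sup>2)"
    using assms by (intro sum.cong) (auto simp: power_mult_distrib)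
  ultimately show ?thesis by simp
qed

locale bounded_graph = weighted_graph E \<omega> \<mu>
  for E :: "'v rel" and \<omega> :: "'v \<Rightarrow> 'v \<Rightarrow> real" and \<mu> :: "'v \<Rightarrow> real" +
  assumes bounded_degree: "finite_D E \<omega> \<mu>"
begin

abbreviation D :: real where "D \<equiv> D_sup E \<omega> \<mu>"
abbreviation deg :: "'v \<Rightarrow> real" where "deg \<equiv> weighted_degree E \<omega>"
abbreviation \<Delta> :: "('v \<Rightarrow> real) \<Rightarrow> 'v \<Rightarrow> real" where "\<Delta> \<equiv> laplacian E \<omega> \<mu>"
abbreviation \<Lambda> :: real where "\<Lambda> \<equiv> spectral_bottom E \<omega> \<mu>"

text \<open>
  Extending the weights by zero off the edges turns neighbourhood sums into sums over arbitrary
  finite sets, whose order can then be exchanged.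
\<close>
definition W :: "'v \<Rightarrow> 'v \<Rightarrow> real" where
  "W x y = (if (x, y) \<in> E then \<omega> x y else 0)"

lemma W_nonneg: "0 \<le> W x y"
  using weight_nonneg by (simp add: W_def)

lemma W_sym: "W x y = W y x"
  using weight_sym[of x y] sym_edges by (auto simp: W_def dest: symD)

lemma edge_sum_eq:
  assumes "finite U" "\<And>y. (x, y) \<in> E \<Longrightarrow> y \<notin> U \<Longrightarrow> f y = 0"
  shows "(\<Sum>y | (x, y) \<in> E. \<omega> x y * f y) = (\<Sum>y\<in>U. W x y * f y)"
proof -
  have "(\<Sum>y | (x, y) \<in> E. \<omega> x y * f y) = (\<Sum>y\<in>{y. (x, y) \<in> E} \<inter> U. \<omega> x y * f y)"
    using assms locally_finite by (intro sum.mono_neutral_right) auto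
  also have "\<dots> = (\<Sum>y\<in>{y. (x, y) \<in> E} \<inter> U. W x y * f y)"
    by (intro sum.cong) (auto simp: W_def)
  also have "\<dots> = (\<Sum>y\<in>U. W x y * f y)"
    using assms by (intro sum.mono_neutral_left) (auto simp: W_def)
  finally show ?thesis .
qed

lemma sum_W_le_deg: "finite U \<Longrightarrow> (\<Sum>y\<in>U. W x y) \<le> deg x"
proof -
  assume U: "finite U"
  have "(\<Sum>y\<in>U. W x y) \<le> (\<Sum>y\<in>U \<union> {y. (x, y) \<in> E}. W x y)"
    using U locally_finite W_nonneg by (intro sum_mono2) auto
  also have "\<dots> = deg x"
    using U locally_finite edge_sum_eq[of "U \<union> {y. (x, y) \<in> E}" x "\<lambda>_. 1"]
    by (simp add: weighted_degree_def)
  finally show ?thesis .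
qed

lemma deg_nonneg: "0 \<le> deg x"
  using weight_nonneg by (simp add: weighted_degree_def sum_nonneg)

lemma deg_le: "deg x \<le> D * \<mu> x"
proof -
  have "deg x / \<mu> x \<le> D"
    unfolding D_sup_def using bounded_degree by (intro cSUP_upper) (auto simp: finite_D_def)
  then show ?thesis using measure_pos[of x] by (simp add: field_simps)
qed

lemma D_nonneg: "0 \<le> D"
  using deg_nonneg[of undefined] deg_le[of undefined] measure_pos[of undefined]
  by (meson order_trans zero_le_mult_iff not_le)

lemma laplacian_eq: "\<mu> x * \<Delta> f x = (\<Sum>y | (x, y) \<in> E. \<omega> x y * f y) - deg x * f x"
  using measure_pos[of x]
  by (simp add: laplacian_def weighted_degree_def right_diff_distrib sum_subtractf sum_distrib_right)

lemma laplacian_eq_on: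
  assumes "finite U" "\<And>y. (x, y) \<in> E \<Longrightarrow> y \<notin> U \<Longrightarrow> f y = 0"
  shows "\<mu> x * \<Delta> f x = (\<Sum>y\<in>U. W x y * f y) - deg x * f x"
  unfolding laplacian_eq using edge_sum_eq[OF assms] by simp

definition edge_form :: "'v set \<Rightarrow> ('v \<Rightarrow> real) \<Rightarrow> ('v \<Rightarrow> real) \<Rightarrow> real" where
  "edge_form U f g = (\<Sum>x\<in>U. \<Sum>y\<in>U. W x y * (f x * g y))"

text \<open>The inner product of \<open>\<ell>\<^sup>2(\<mu>)\<close>, restricted to a finite set of vertices.\<close>
definition dot :: "'v set \<Rightarrow> ('v \<Rightarrow> real) \<Rightarrow> ('v \<Rightarrow> real) \<Rightarrow> real" where
  "dot U f g = (\<Sum>x\<in>U. \<mu> x * (f x * g x))"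

lemma dot_nonneg: "0 \<le> dot U f f"
  unfolding dot_def using measure_pos
  by (intro sum_nonneg mult_nonneg_nonneg zero_le_square) (simp add: less_imp_le)

text \<open>
  Bounding \<open>\<bar>f x * f y\<bar>\<close> by the mean of the two squares makes each edge contribute equally to its two
  ends; by symmetry of the weights the total is a sum of squares weighted by the degree.
  The factor \<open>c\<close> serves for both the plain edge form and its exponentially twisted version.
\<close>
lemma edge_sum_le:
  assumes "finite U" and C: "0 \<le> C"
    and c: "\<And>x y. x \<in> U \<Longrightarrow> y \<in> U \<Longrightarrow> (x, y) \<in> E \<Longrightarrow> \<bar>c x y\<bar> \<le> C"
  shows "\<bar>\<Sum>x\<in>U. \<Sum>y\<in>U. W x y * (c x y * (f x * f y))\<bar> \<le> C * (\<Sum>x\<in>U. deg x * (f x)\<^sup>2)"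
proof -
  have "\<bar>\<Sum>x\<in>U. \<Sum>y\<in>U. W x y * (c x y * (f x * f y))\<bar>
      \<le> (\<Sum>x\<in>U. \<Sum>y\<in>U. \<bar>W x y * (c x y * (f x * f y))\<bar>)"
    by (intro order_trans[OF sum_abs] sum_mono sum_abs)
  also have "\<dots> \<le> (\<Sum>x\<in>U. \<Sum>y\<in>U. C / 2 * (W x y * (f x)\<^sup>2 + W y x * (f y)\<^sup>2))"
  proof (intro sum_mono)
    fix x y assume xy: "x \<in> U" "y \<in> U"
    have "\<bar>f x * f y\<bar> \<le> ((f x)\<^sup>2 + (f y)\<^sup>2) / 2"
      using sum_squares_bound[of "\<bar>f x\<bar>" "\<bar>f y\<bar>"] by (simp add: abs_mult)
    then have "\<bar>c x y\<bar> * \<bar>f x * f y\<bar> \<le> C * (((f x)\<^sup>2 + (f y)\<^sup>2) / 2)" if "(x, y) \<in> E"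
      using c[OF xy that] C by (intro mult_mono) auto
    then have "W x y * (\<bar>c x y\<bar> * \<bar>f x * f y\<bar>) \<le> W x y * (C * (((f x)\<^sup>2 + (f y)\<^sup>2) / 2))"
      using W_nonneg[of x y] by (cases "(x, y) \<in> E") (auto simp: W_def intro!: mult_left_mono simp del: times_divide_eq_right)
    then show "\<bar>W x y * (c x y * (f x * f y))\<bar> \<le> C / 2 * (W x y * (f x)\<^sup>2 + W y x * (f y)\<^sup>2)"
      using W_nonneg[of x y] by (simp add: abs_mult W_sym[of y x] algebra_simps)
  qed
  also have "\<dots> = C / 2 * ((\<Sum>x\<in>U. \<Sum>y\<in>U. W x y * (f x)\<^sup>2) + (\<Sum>x\<in>U. \<Sum>y\<in>U. W y x * (f y)\<^sup>2))"
    by (simp only: sum.distrib flip: sum_distrib_left)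
  also have "\<dots> = C * (\<Sum>x\<in>U. \<Sum>y\<in>U. W x y * (f x)\<^sup>2)"
    using sum.swap[of "\<lambda>x y. W x y * (f x)\<^sup>2" U U] by simp
  also have "\<dots> \<le> C * (\<Sum>x\<in>U. deg x * (f x)\<^sup>2)"
    using C assms(1) sum_W_le_deg
    by (intro mult_left_mono sum_mono) (auto simp flip: sum_distrib_right intro: mult_right_mono)
  finally show ?thesis .
qed

section \<open>The averaging operator on square-summable functions\<close>

text \<open>
  Adding \<open>D\<close> to the Laplacian gives an operator with the nonnegative symmetric kernel below (with
  respect to \<open>\<mu>\<close>); the diagonal entry is nonnegative exactly because \<open>D\<close> bounds the weighted degree
  relative to \<open>\<mu>\<close>. Nonnegativity gives the norm bound \<open>D\<close> by Cauchy-Schwarz, and later the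
  monotonicity of heat kernels in the domain.
\<close>
definition jump :: "'v \<Rightarrow> 'v \<Rightarrow> real" where
  "jump x y = W x y + (if x = y then D * \<mu> x - deg x else 0)"

lemma jump_nonneg: "0 \<le> jump x y"
  using W_nonneg[of x y] deg_le[of x] by (auto simp: jump_def)

lemma jump_sym: "jump x y = jump y x"
  using W_sym[of x y] by (simp add: jump_def)

lemma jump_row_sum: "finite U \<Longrightarrow> (\<Sum>y\<in>U. jump x y) \<le> D * \<mu> x"
  using sum_W_le_deg[of U x] deg_le[of x] by (simp add: jump_def sum.distrib sum.delta)

definition averaging :: "('v \<Rightarrow> real) \<Rightarrow> 'v \<Rightarrow> real" where
  "averaging f x = D * f x + \<Delta> f x"

lemma averaging_eq_on:
  assumes "finite U" "x \<in> U" "\<And>y. (x, y) \<in> E \<Longrightarrow> y \<notin> U \<Longrightarrow> f y = 0"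
  shows "\<mu> x * averaging f x = (\<Sum>y\<in>U. jump x y * f y)"
proof -
  have "(\<Sum>y\<in>U. jump x y * f y)
      = (\<Sum>y\<in>U. W x y * f y) + (\<Sum>y\<in>U. if y = x then (D * \<mu> x - deg x) * f x else 0)"
    unfolding sum.distrib[symmetric] by (intro sum.cong) (auto simp: jump_def algebra_simps)
  then show ?thesis
    using laplacian_eq_on[of U x f] assms
    by (simp add: averaging_def algebra_simps)
qed

definition closed_nbhd :: "'v set \<Rightarrow> 'v set" where
  "closed_nbhd F = F \<union> (\<Union>x\<in>F. {y. (x, y) \<in> E})"

lemma finite_closed_nbhd: "finite F \<Longrightarrow> finite (closed_nbhd F)"
  using locally_finite by (simp add: closed_nbhd_def)

text \<open>
  Schur's test: both the rows and, by symmetry, the columns of \<open>jump\<close> sum to at most \<open>D * \<mu>\<close>.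
  The neighbours of \<open>F\<close> have to be included on the right since averaging reads their values.
\<close>
lemma dot_averaging_le:
  assumes "finite F"
  shows "dot F (averaging f) (averaging f) \<le> D\<^sup>2 * dot (closed_nbhd F) f f"
proof -
  let ?G = "closed_nbhd F"
  have G: "finite ?G" "F \<subseteq> ?G"
    using assms finite_closed_nbhd by (auto simp: closed_nbhd_def)
  have "\<mu> x * (averaging f x * averaging f x) \<le> D * (\<Sum>y\<in>?G. jump x y * (f y)\<^sup>2)" if "x \<in> F" for x
  proof -
    have "\<mu> x * averaging f x = (\<Sum>y\<in>?G. jump x y * f y)"
      using that by (intro averaging_eq_on G) (auto simp: closed_nbhd_def)
    then have "(\<mu> x * averaging f x)\<^sup>2 \<le> (\<Sum>y\<in>?G. jump x y) * (\<Sum>y\<in>?G. jump x y * (f y)\<^sup>2)"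
      using weighted_sum_square_le[of ?G "jump x" f] jump_nonneg by simp
    also have "\<dots> \<le> (D * \<mu> x) * (\<Sum>y\<in>?G. jump x y * (f y)\<^sup>2)"
      using jump_row_sum[OF G(1)] jump_nonneg by (intro mult_right_mono sum_nonneg) auto
    finally have "\<mu> x * (\<mu> x * (averaging f x * averaging f x))
        \<le> \<mu> x * (D * (\<Sum>y\<in>?G. jump x y * (f y)\<^sup>2))"
      by (simp add: power2_eq_square mult_ac)
    then show ?thesis using measure_pos[of x] by simp
  qed
  then have "dot F (averaging f) (averaging f) \<le> (\<Sum>x\<in>F. D * (\<Sum>y\<in>?G. jump x y * (f y)\<^sup>2))"
    unfolding dot_def by (intro sum_mono) auto
  also have "\<dots> \<le> (\<Sum>x\<in>?G. D * (\<Sum>y\<in>?G. jump x y * (f y)\<^sup>2))"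
    using G D_nonneg jump_nonneg by (intro sum_mono2 mult_nonneg_nonneg sum_nonneg) auto
  also have "\<dots> = D * (\<Sum>x\<in>?G. \<Sum>y\<in>?G. jump y x * (f y)\<^sup>2)"
    by (simp add: sum_distrib_left jump_sym)
  also have "\<dots> = D * (\<Sum>y\<in>?G. (\<Sum>x\<in>?G. jump y x) * (f y)\<^sup>2)"
    by (subst sum.swap) (simp add: sum_distrib_right)
  also have "\<dots> \<le> D * (\<Sum>y\<in>?G. (D * \<mu> y) * (f y)\<^sup>2)"
    using jump_row_sum[OF G(1)] D_nonneg by (intro mult_left_mono sum_mono mult_right_mono) auto
  also have "\<dots> = D\<^sup>2 * dot ?G f f"
    by (simp add: dot_def sum_distrib_left power2_eq_square mult_ac)
  finally show ?thesis .
qed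

text \<open>
  Norm bounds for infinite sums are obtained from bounds on finite sets, so that only finite sums
  have to be rearranged.
\<close>
lemma ell2I:
  assumes "\<And>F. finite F \<Longrightarrow> dot F f f \<le> B\<^sup>2" "0 \<le> B"
  shows "f \<in> ell2 \<mu>" "ell2_norm \<mu> f \<le> B"
proof -
  have le: "(\<Sum>x\<in>F. \<mu> x * (f x)\<^sup>2) \<le> B\<^sup>2" if "finite F" for F
    using assms(1)[OF that] by (simp add: dot_def power2_eq_square)
  then have s: "(\<lambda>x. \<mu> x * (f x)\<^sup>2) summable_on UNIV"
    using measure_pos
    by (intro nonneg_bdd_above_summable_on) (auto simp: less_imp_le intro!: bdd_aboveI2)
  then show "f \<in> ell2 \<mu>" by (simp add: ell2_def)
  have "(\<Sum>\<^sub>\<infinity>x. \<mu> x * (f x)\<^sup>2) \<le> B\<^sup>2"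
    using s le by (intro infsum_le_finite_sums) auto
  then show "ell2_norm \<mu> f \<le> B"
    unfolding ell2_norm_def using assms(2) real_le_lsqrt by blast
qed

lemma ell2_norm_nonneg: "0 \<le> ell2_norm \<mu> f"
  unfolding ell2_norm_def using measure_pos
  by (intro real_sqrt_ge_zero infsum_nonneg mult_nonneg_nonneg) (auto simp: less_imp_le)

lemma dot_le_ell2_norm:
  assumes "f \<in> ell2 \<mu>" "finite F"
  shows "dot F f f \<le> (ell2_norm \<mu> f)\<^sup>2"
proof -
  have "(\<Sum>x\<in>F. \<mu> x * (f x)\<^sup>2) \<le> (\<Sum>\<^sub>\<infinity>x. \<mu> x * (f x)\<^sup>2)"
    using assms measure_pos
    by (intro finite_sum_le_infsum) (auto simp: ell2_def less_imp_le)
  moreover have "0 \<le> (\<Sum>\<^sub>\<infinity>x. \<mu> x * (f x)\<^sup>2)"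
    using measure_pos by (intro infsum_nonneg mult_nonneg_nonneg) (auto simp: less_imp_le)
  ultimately show ?thesis
    by (simp add: dot_def ell2_norm_def power2_eq_square)
qed

lemma averaging_ell2:
  assumes "f \<in> ell2 \<mu>"
  shows "averaging f \<in> ell2 \<mu>" "ell2_norm \<mu> (averaging f) \<le> D * ell2_norm \<mu> f"
proof -
  have "dot F (averaging f) (averaging f) \<le> (D * ell2_norm \<mu> f)\<^sup>2" if "finite F" for F
  proof -
    have "dot F (averaging f) (averaging f) \<le> D\<^sup>2 * dot (closed_nbhd F) f f"
      by (rule dot_averaging_le[OF that])
    also have "\<dots> \<le> D\<^sup>2 * (ell2_norm \<mu> f)\<^sup>2"
      using dot_le_ell2_norm[OF assms finite_closed_nbhd[OF that]] by (intro mult_left_mono) auto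
    finally show ?thesis by (simp add: power_mult_distrib)
  qed
  then show "averaging f \<in> ell2 \<mu>" "ell2_norm \<mu> (averaging f) \<le> D * ell2_norm \<mu> f"
    using ell2I[of "averaging f" "D * ell2_norm \<mu> f"] D_nonneg ell2_norm_nonneg[of f] by auto
qed

lemma averaging_power_ell2:
  assumes "f \<in> ell2 \<mu>"
  shows "(averaging ^^ n) f \<in> ell2 \<mu> \<and> ell2_norm \<mu> ((averaging ^^ n) f) \<le> D ^ n * ell2_norm \<mu> f"
proof (induction n)
  case (Suc n)
  then have "ell2_norm \<mu> (averaging ((averaging ^^ n) f)) \<le> D * (D ^ n * ell2_norm \<mu> f)"
    using averaging_ell2(2)[of "(averaging ^^ n) f"] D_nonneg
    by (meson mult_left_mono order_trans)
  then show ?case using Suc averaging_ell2(1) by (simp add: mult.assoc)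
qed (use assms in simp)

lemma averaging_power_dot:
  assumes "f \<in> ell2 \<mu>" "finite F"
  shows "dot F ((averaging ^^ n) f) ((averaging ^^ n) f) \<le> (D ^ n * ell2_norm \<mu> f)\<^sup>2"
  using dot_le_ell2_norm[of "(averaging ^^ n) f" F] averaging_power_ell2[OF assms(1), of n] assms(2)
  by (meson ell2_norm_nonneg order_trans power_mono)

lemma averaging_power_pointwise:
  assumes "f \<in> ell2 \<mu>"
  shows "\<bar>(averaging ^^ n) f x\<bar> \<le> D ^ n * (ell2_norm \<mu> f / sqrt (\<mu> x))"
proof -
  have "\<mu> x * ((averaging ^^ n) f x)\<^sup>2 \<le> (D ^ n * ell2_norm \<mu> f)\<^sup>2"
    using averaging_power_dot[OF assms, of "{x}" n] by (simp add: dot_def power2_eq_square)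
  then have "sqrt (\<mu> x * ((averaging ^^ n) f x)\<^sup>2) \<le> D ^ n * ell2_norm \<mu> f"
    using D_nonneg ell2_norm_nonneg[of f] by (intro real_le_lsqrt) auto
  then show ?thesis
    using measure_pos[of x] by (simp add: real_sqrt_mult field_simps)
qed

lemma averaging_linear:
  "averaging (\<lambda>x. f x + g x) = (\<lambda>x. averaging f x + averaging g x)"
  "averaging (\<lambda>x. c * f x) = (\<lambda>x. c * averaging f x)"
  by (auto simp: averaging_def laplacian_def fun_eq_iff algebra_simps sum.distrib sum_subtractf
      sum_distrib_left)

lemma averaging_power_linear:
  "(averaging ^^ n) (\<lambda>x. f x + g x) = (\<lambda>x. (averaging ^^ n) f x + (averaging ^^ n) g x)"
  "(averaging ^^ n) (\<lambda>x. c * f x) = (\<lambda>x. c * (averaging ^^ n) f x)"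
  by (induction n) (auto simp: averaging_linear)

lemma dot_triangle: "sqrt (dot F (\<lambda>x. f x + g x) (\<lambda>x. f x + g x)) \<le> sqrt (dot F f f) + sqrt (dot F g g)"
proof -
  have *: "sqrt (dot F h h) = L2_set (\<lambda>x. sqrt (\<mu> x) * h x) F" for h
    using measure_pos
    by (auto simp: dot_def L2_set_def power_mult_distrib less_imp_le power2_eq_square
        intro!: arg_cong[where f = sqrt] sum.cong)
  show ?thesis
    unfolding * using L2_set_triangle_ineq[of "\<lambda>x. sqrt (\<mu> x) * f x" "\<lambda>x. sqrt (\<mu> x) * g x" F]
    by (simp add: distrib_left)
qed

section \<open>The spectrum is bounded below\<close>

text \<open>
  The Neumann series of the inverse of \<open>s - averaging\<close>. It is summed pointwise;
  membership of the sum in \<open>\<ell>\<^sup>2\<close> comes from bounds on finite sets that are uniform in the set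
  and in the length of the partial sum.
\<close>
definition resolvent :: "real \<Rightarrow> ('v \<Rightarrow> real) \<Rightarrow> 'v \<Rightarrow> real" where
  "resolvent s f x = (\<Sum>n. (averaging ^^ n) f x / s ^ Suc n)"

context
  fixes s :: real
  assumes s: "D < s"
begin

lemma s_pos: "0 < s" using s D_nonneg by linarith

lemma geometric: "(\<lambda>n. D ^ n / s ^ Suc n) sums (1 / (s - D))"
proof -
  have "(\<lambda>n. (1 / s) * (D / s) ^ n) sums ((1 / s) * (1 / (1 - D / s)))"
    using s D_nonneg by (intro sums_mult geometric_sums) auto
  then show ?thesis using s s_pos by (simp add: field_simps)
qed

lemma resolvent_summable:
  assumes "f \<in> ell2 \<mu>"
  shows "summable (\<lambda>n. (averaging ^^ n) f x / s ^ Suc n)"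
proof (rule summable_comparison_test'[where N = 0])
  show "summable (\<lambda>n. D ^ n / s ^ Suc n * (ell2_norm \<mu> f / sqrt (\<mu> x)))"
    using geometric by (intro summable_mult2) (rule sums_summable)
  show "norm ((averaging ^^ n) f x / s ^ Suc n)
      \<le> D ^ n / s ^ Suc n * (ell2_norm \<mu> f / sqrt (\<mu> x))" for n
    using divide_right_mono[OF averaging_power_pointwise[OF assms, of n x], of "s ^ Suc n"] s_pos
    by (simp add: mult_ac del: power_Suc)
qed

lemma resolvent_bounded:
  assumes f: "f \<in> ell2 \<mu>"
  shows "resolvent s f \<in> ell2 \<mu>" "ell2_norm \<mu> (resolvent s f) \<le> 1 / (s - D) * ell2_norm \<mu> f"
proof -
  let ?B = "1 / (s - D) * ell2_norm \<mu> f"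
  have B: "0 \<le> ?B" using s ell2_norm_nonneg[of f] by simp
  have "dot F (resolvent s f) (resolvent s f) \<le> ?B\<^sup>2" if F: "finite F" for F
  proof -
    define S where "S k x = (\<Sum>n<k. (averaging ^^ n) f x / s ^ Suc n)" for k x
    have part: "sqrt (dot F (S k) (S k)) \<le> (\<Sum>n<k. D ^ n / s ^ Suc n) * ell2_norm \<mu> f" for k
    proof (induction k)
      case 0
      then show ?case by (simp add: S_def dot_def)
    next
      case (Suc k)
      let ?g = "\<lambda>x. (averaging ^^ k) f x / s ^ Suc k"
      have "dot F ?g ?g = dot F ((averaging ^^ k) f) ((averaging ^^ k) f) / (s ^ Suc k)\<^sup>2"
        by (simp add: dot_def sum_divide_distrib power2_eq_square mult_ac)
      then have "sqrt (dot F ?g ?g) = sqrt (dot F ((averaging ^^ k) f) ((averaging ^^ k) f)) / s ^ Suc k"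
        using s_pos by (simp add: real_sqrt_divide del: power_Suc)
      also have "\<dots> \<le> (D ^ k * ell2_norm \<mu> f) / s ^ Suc k"
        using averaging_power_dot[OF f F, of k] D_nonneg ell2_norm_nonneg[of f] s_pos
        by (intro divide_right_mono real_le_lsqrt) auto
      finally have "sqrt (dot F ?g ?g) \<le> D ^ k / s ^ Suc k * ell2_norm \<mu> f" by simp
      moreover have "S (Suc k) = (\<lambda>x. S k x + ?g x)" by (simp add: S_def fun_eq_iff)
      ultimately show ?case
        using dot_triangle[of F "S k" ?g] Suc by (simp add: distrib_right del: power_Suc)
    qed
    have "dot F (S k) (S k) \<le> ?B\<^sup>2" for k
    proof -
      have "(\<Sum>n<k. D ^ n / s ^ Suc n) \<le> 1 / (s - D)"
        using sum_le_suminf[of "\<lambda>n. D ^ n / s ^ Suc n" "{..<k}"] geometric s_pos D_nonneg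
        by (auto simp: sums_iff)
      then have "sqrt (dot F (S k) (S k)) \<le> ?B"
        using part[of k] ell2_norm_nonneg[of f] by (meson mult_right_mono order_trans)
      then show ?thesis using B by (simp add: sqrt_le_D)
    qed
    moreover have "(\<lambda>k. S k x) \<longlonglongrightarrow> resolvent s f x" for x
      unfolding S_def resolvent_def by (rule summable_LIMSEQ[OF resolvent_summable[OF f]])
    then have "(\<lambda>k. dot F (S k) (S k)) \<longlonglongrightarrow> dot F (resolvent s f) (resolvent s f)"
      unfolding dot_def by (intro tendsto_intros)
    ultimately show ?thesis by (intro LIMSEQ_le_const2) auto
  qed
  then show "resolvent s f \<in> ell2 \<mu>" "ell2_norm \<mu> (resolvent s f) \<le> ?B"
    using ell2I B by blast+
qed

lemma ell2_bounded_operator_resolvent: "ell2_bounded_operator \<mu> (resolvent s)"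
  unfolding ell2_bounded_operator_def
proof (intro conjI ballI allI exI[of _ "1 / (s - D)"])
  show "resolvent s (\<lambda>x. f x + g x) = (\<lambda>x. resolvent s f x + resolvent s g x)"
    if "f \<in> ell2 \<mu>" "g \<in> ell2 \<mu>" for f g
    using that resolvent_summable
    by (auto simp: resolvent_def averaging_power_linear suminf_add add_divide_distrib fun_eq_iff)
  show "resolvent s (\<lambda>x. c * f x) = (\<lambda>x. c * resolvent s f x)" if "f \<in> ell2 \<mu>" for f c
    using suminf_mult[OF resolvent_summable[OF that], of c]
    by (auto simp: resolvent_def averaging_power_linear fun_eq_iff)
qed (use resolvent_bounded in auto)

text \<open>By local finiteness, averaging reads finitely many values and so commutes with the series.\<close>
lemma averaging_resolvent:
  assumes "f \<in> ell2 \<mu>"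
  shows "averaging (resolvent s f) x = (\<Sum>n. (averaging ^^ Suc n) f x / s ^ Suc n)"
proof -
  let ?G = "closed_nbhd {x}"
  have av: "averaging h x = (\<Sum>y\<in>?G. jump x y / \<mu> x * h y)" for h
    using averaging_eq_on[of ?G x h] finite_closed_nbhd[of "{x}"] measure_pos[of x]
    by (simp add: closed_nbhd_def field_simps flip: sum_divide_distrib)
  have "(\<Sum>n. (averaging ^^ Suc n) f x / s ^ Suc n)
      = (\<Sum>n. \<Sum>y\<in>?G. jump x y / \<mu> x * ((averaging ^^ n) f y / s ^ Suc n))"
    by (simp add: av[of "(averaging ^^ _) f"] sum_divide_distrib del: power_Suc)
  also have "\<dots> = (\<Sum>y\<in>?G. \<Sum>n. jump x y / \<mu> x * ((averaging ^^ n) f y / s ^ Suc n))"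
    by (intro suminf_sum summable_mult resolvent_summable assms)
  also have "\<dots> = (\<Sum>y\<in>?G. jump x y / \<mu> x * resolvent s f y)"
    unfolding resolvent_def by (intro sum.cong refl suminf_mult resolvent_summable assms)
  finally show ?thesis by (simp add: av)
qed

lemma resolvent_telescope:
  assumes "f \<in> ell2 \<mu>"
  shows "(\<Sum>n. (s * (averaging ^^ n) f x - (averaging ^^ Suc n) f x) / s ^ Suc n) = f x"
proof -
  let ?a = "\<lambda>n. (averaging ^^ n) f x / s ^ n"
  have "(\<lambda>n. s * ((averaging ^^ n) f x / s ^ Suc n)) \<longlonglongrightarrow> s * 0"
    by (intro tendsto_intros summable_LIMSEQ_zero resolvent_summable assms)
  then have "?a \<longlonglongrightarrow> 0" using s_pos by simp
  then have "(\<lambda>n. ?a n - ?a (Suc n)) sums (?a 0 - 0)" by (rule telescope_sums')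
  moreover have "?a n - ?a (Suc n) = (s * (averaging ^^ n) f x - (averaging ^^ Suc n) f x) / s ^ Suc n" for n
    using s_pos by (simp add: field_simps)
  ultimately show ?thesis by (simp add: sums_iff)
qed

text \<open>
  Since \<open>-\<Delta> - (D - s)\<close> equals \<open>s - averaging\<close>, the Neumann series is the inverse whose existence
  excludes \<open>D - s\<close> from the spectrum.
\<close>
lemma not_in_spectrum: "D - s \<notin> ell2_spectrum \<mu> (\<lambda>f x. - \<Delta> f x)"
proof -
  have eq: "- \<Delta> f x - (D - s) * f x = s * f x - averaging f x" for f x
    by (simp add: averaging_def algebra_simps)
  have "resolvent s (\<lambda>x. s * f x - averaging f x) x = f x" if f: "f \<in> ell2 \<mu>" for f x
  proof -
    have "(averaging ^^ n) (\<lambda>x. s * f x - averaging f x) x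
        = s * (averaging ^^ n) f x - (averaging ^^ Suc n) f x" for n
      using averaging_power_linear(1)[of n "\<lambda>x. s * f x" "\<lambda>x. -1 * averaging f x"]
      by (simp only: averaging_power_linear(2)) (simp add: funpow_swap1)
    then show ?thesis
      using resolvent_telescope[OF f] by (simp add: resolvent_def del: power_Suc funpow.simps)
  qed
  moreover have "s * resolvent s f x - averaging (resolvent s f) x = f x" if f: "f \<in> ell2 \<mu>" for f x
  proof -
    have "summable (\<lambda>n. (averaging ^^ Suc n) f x / s ^ Suc n)"
      using resolvent_summable[OF f, of x, THEN summable_mult, of s, THEN summable_Suc_iff[THEN iffD2]] s_pos
      by simp
    then have "(\<lambda>n. (averaging ^^ Suc n) f x / s ^ Suc n) sums averaging (resolvent s f) x"
      unfolding averaging_resolvent[OF f] by (rule summable_sums)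
    moreover have "(\<lambda>n. s * ((averaging ^^ n) f x / s ^ Suc n)) sums (s * resolvent s f x)"
      unfolding resolvent_def by (intro sums_mult summable_sums resolvent_summable f)
    ultimately have "(\<lambda>n. (s * (averaging ^^ n) f x - (averaging ^^ Suc n) f x) / s ^ Suc n)
        sums (s * resolvent s f x - averaging (resolvent s f) x)"
      by (auto dest: sums_diff simp: diff_divide_distrib simp del: power_Suc funpow.simps)
    then show ?thesis
      using resolvent_telescope[OF f, of x] by (simp only: sums_iff)
  qed
  ultimately show ?thesis
    unfolding ell2_spectrum_def mem_Collect_eq not_not eq
    by (intro exI[of _ "resolvent s"] conjI ell2_bounded_operator_resolvent ballI) auto
qed

end

lemma spectrum_nonneg: "c \<in> ell2_spectrum \<mu> (\<lambda>f x. - \<Delta> f x) \<Longrightarrow> 0 \<le> c"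
  using not_in_spectrum[of "D - c"] by fastforce

section \<open>The bottom of the spectrum and Rayleigh quotients\<close>

text \<open>The bilinear form \<open>\<langle>f, -\<Delta> g\<rangle>\<close> for functions supported in \<open>U\<close>.\<close>
definition dirichlet_form :: "'v set \<Rightarrow> ('v \<Rightarrow> real) \<Rightarrow> ('v \<Rightarrow> real) \<Rightarrow> real" where
  "dirichlet_form U f g = (\<Sum>x\<in>U. deg x * (f x * g x)) - edge_form U f g"

lemma dot_laplacian:
  assumes "finite U" "\<And>x. x \<notin> U \<Longrightarrow> g x = 0"
  shows "dot U f (\<Delta> g) = - dirichlet_form U f g"
proof -
  have "dot U f (\<Delta> g) = (\<Sum>x\<in>U. f x * (\<mu> x * \<Delta> g x))"
    by (simp add: dot_def mult_ac)
  also have "\<dots> = (\<Sum>x\<in>U. f x * ((\<Sum>y\<in>U. W x y * g y) - deg x * g x))"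
    using assms by (intro sum.cong) (simp_all add: laplacian_eq_on[of U])
  also have "\<dots> = - dirichlet_form U f g"
    by (simp add: dirichlet_form_def edge_form_def algebra_simps sum_subtractf sum_distrib_left)
  finally show ?thesis .
qed

lemma dirichlet_form_bounds:
  assumes "finite U"
  shows "0 \<le> dirichlet_form U f f" "dirichlet_form U f f \<le> 2 * D * dot U f f"
proof -
  have "\<bar>edge_form U f f\<bar> \<le> (\<Sum>x\<in>U. deg x * (f x * f x))"
    using edge_sum_le[OF assms, of 1 "\<lambda>_ _. 1" f] by (simp add: edge_form_def power2_eq_square)
  moreover have "(\<Sum>x\<in>U. deg x * (f x * f x)) \<le> D * dot U f f"
    unfolding dot_def sum_distrib_left mult.assoc[symmetric, of D] using deg_le
    by (intro sum_mono mult_right_mono) auto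
  ultimately show "0 \<le> dirichlet_form U f f" "dirichlet_form U f f \<le> 2 * D * dot U f f"
    by (auto simp: dirichlet_form_def)
qed

lemma edge_form_sym: "edge_form U f g = edge_form U g f"
  unfolding edge_form_def by (subst sum.swap) (simp add: W_sym mult_ac)

lemma dirichlet_form_diff:
  "dirichlet_form U (\<lambda>x. f x - c * g x) (\<lambda>x. f x - c * g x)
    = dirichlet_form U f f - 2 * c * dirichlet_form U g f + c\<^sup>2 * dirichlet_form U g g"
proof -
  have "edge_form U (\<lambda>x. f x - c * g x) (\<lambda>x. f x - c * g x)
    = edge_form U f f - c * edge_form U g f - c * edge_form U f g + c\<^sup>2 * edge_form U g g"
    by (simp add: edge_form_def algebra_simps power2_eq_square sum.distrib sum_subtractf sum_distrib_left)
  then show ?thesis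
    by (simp add: dirichlet_form_def edge_form_sym[of U f g] algebra_simps power2_eq_square sum.distrib
        sum_subtractf sum_distrib_left)
qed

lemma dot_diff:
  "dot U (\<lambda>x. f x - c * g x) (\<lambda>x. f x - c * g x)
    = dot U f f - 2 * c * dot U g f + c\<^sup>2 * dot U g g"
  by (simp add: dot_def algebra_simps power2_eq_square sum.distrib sum_subtractf sum_distrib_left)

lemma ell2_finite_support:
  assumes "finite U" "\<And>x. x \<notin> U \<Longrightarrow> f x = 0"
  shows "f \<in> ell2 \<mu>" "(ell2_norm \<mu> f)\<^sup>2 = dot U f f"
proof -
  have "(\<Sum>\<^sub>\<infinity>x. \<mu> x * (f x)\<^sup>2) = (\<Sum>\<^sub>\<infinity>x\<in>U. \<mu> x * (f x)\<^sup>2)"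
    using assms by (intro infsum_cong_neutral) auto
  then have "(\<Sum>\<^sub>\<infinity>x. \<mu> x * (f x)\<^sup>2) = dot U f f"
    using assms(1) by (simp add: dot_def power2_eq_square)
  then show "(ell2_norm \<mu> f)\<^sup>2 = dot U f f"
    using dot_nonneg by (simp add: ell2_norm_def)
  have "(\<lambda>x. \<mu> x * (f x)\<^sup>2) summable_on U"
    using assms by simp
  then show "f \<in> ell2 \<mu>"
    unfolding ell2_def mem_Collect_eq
    by (rule summable_on_cong_neutral[THEN iffD1, rotated -1]) (use assms in auto)
qed

text \<open>
  Both forms read \<open>f\<close> on \<open>U\<close> only, so the pairs \<open>U\<close>, \<open>f\<close> amount to the nonzero finitely supported
  functions.
\<close>
definition rayleigh_quotients :: "real set" where
  "rayleigh_quotients = {dirichlet_form U f f / dot U f f | U f. finite U \<and> 0 < dot U f f}"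

lemma rayleigh_quotients_bdd: "bdd_below rayleigh_quotients"
  using dirichlet_form_bounds(1) dot_nonneg
  by (intro bdd_belowI[of _ 0]) (auto simp: rayleigh_quotients_def)

lemma rayleigh_quotients_nonempty: "rayleigh_quotients \<noteq> {}"
  using measure_pos[of undefined]
  by (auto simp: rayleigh_quotients_def dot_def intro!: exI[of _ "{undefined}"] exI[of _ "\<lambda>_. 1"])

lemma rayleigh_inf_le:
  assumes "finite U"
  shows "Inf rayleigh_quotients * dot U f f \<le> dirichlet_form U f f"
proof (cases "dot U f f = 0")
  case True
  then show ?thesis using dirichlet_form_bounds(1)[OF assms] by simp
next
  case False
  then have "0 < dot U f f" using dot_nonneg[of U f] by linarith
  moreover from this have "Inf rayleigh_quotients \<le> dirichlet_form U f f / dot U f f"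
    using assms by (intro cInf_lower rayleigh_quotients_bdd) (auto simp: rayleigh_quotients_def)
  ultimately show ?thesis by (simp add: field_simps)
qed

text \<open>
  Let \<open>l\<close> be the infimum of the Rayleigh quotients and \<open>A = -\<Delta> - l\<close>, a nonnegative operator on
  finitely supported functions. Testing nonnegativity on \<open>h - A h / K\<close> gives
  \<open>\<parallel>A h\<parallel>\<^sup>2 \<le> K \<langle>A h, h\<rangle>\<close>. If \<open>l\<close> were not in the spectrum, then \<open>\<parallel>h\<parallel> \<le> C \<parallel>A h\<parallel>\<close> and hence
  \<open>\<langle>A h, h\<rangle> \<ge> e \<parallel>h\<parallel>\<^sup>2\<close> with some \<open>e > 0\<close>, and \<open>l\<close> could be raised to \<open>l + e\<close>.
\<close>
lemma rayleigh_inf_in_spectrum: "Inf rayleigh_quotients \<in> ell2_spectrum \<mu> (\<lambda>f x. - \<Delta> f x)"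
proof (rule ccontr)
  define l where "l = Inf rayleigh_quotients"
  have l0: "0 \<le> l"
    unfolding l_def using dirichlet_form_bounds(1) dot_nonneg
    by (intro cInf_greatest rayleigh_quotients_nonempty) (auto simp: rayleigh_quotients_def)
  assume "Inf rayleigh_quotients \<notin> ell2_spectrum \<mu> (\<lambda>f x. - \<Delta> f x)"
  then obtain R where R: "ell2_bounded_operator \<mu> R"
    and RA: "\<And>f. f \<in> ell2 \<mu> \<Longrightarrow> R (\<lambda>x. - \<Delta> f x - l * f x) = f"
    unfolding ell2_spectrum_def l_def by auto
  from R obtain C where C: "\<And>f. f \<in> ell2 \<mu> \<Longrightarrow> ell2_norm \<mu> (R f) \<le> C * ell2_norm \<mu> f"
    unfolding ell2_bounded_operator_def by blast
  \<comment> \<open>\<open>2 * D\<close> bounds the quadratic form of \<open>A\<close>; the summand 1 here and in \<open>\<bar>C\<bar> + 1\<close> keeps denominators positive\<close>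
  define K where "K = 2 * D + 1"
  have K: "0 < K" using D_nonneg by (simp add: K_def)
  define e where "e = 1 / ((\<bar>C\<bar> + 1)\<^sup>2 * K)"
  have e: "0 < e" using K by (simp add: e_def)
  have gap: "(l + e) * dot U f f \<le> dirichlet_form U f f" if U: "finite U" for U f
  proof -
    define h where "h x = (if x \<in> U then f x else 0)" for x
    define A where "A x = - \<Delta> h x - l * h x" for x
    \<comment> \<open>local finiteness: \<open>A\<close> is supported in the finite set of vertices at distance at most one from \<open>U\<close>\<close>
    define G where "G = closed_nbhd U"
    have G: "finite G" "U \<subseteq> G"
      using finite_closed_nbhd[OF U] by (auto simp: G_def closed_nbhd_def)
    have hG: "h x = 0" if "x \<notin> G" for x using that G by (auto simp: h_def)
    have AG: "A x = 0" if "x \<notin> G" for x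
    proof -
      have "y \<notin> U" if "(x, y) \<in> E" for y
        using that \<open>x \<notin> G\<close> sym_edges by (auto simp: G_def closed_nbhd_def dest: symD)
      then have "(\<Sum>y | (x, y) \<in> E. \<omega> x y * (h y - h x)) = 0"
        using hG[OF that] by (intro sum.neutral) (auto simp: h_def)
      then show ?thesis using hG[OF that] by (simp add: A_def laplacian_def)
    qed
    define a where "a = dot G A A"
    define X where "X = dirichlet_form G h h - l * dot G h h"
    have "dot G A A = - dot G A (\<Delta> h) - l * dot G A h"
      by (simp add: A_def[of x for x] dot_def algebra_simps sum.distrib sum_subtractf
          sum_negf sum_distrib_left)
    then have Ah: "dirichlet_form G A h - l * dot G A h = a"
      using dot_laplacian[OF G(1), of h A] hG by (simp add: a_def)
    have AA: "dirichlet_form G A A - l * dot G A A \<le> K * a"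
      using dirichlet_form_bounds(2)[OF G(1), of A] dot_nonneg[of G A] mult_nonneg_nonneg[OF l0 dot_nonneg[of G A]]
      unfolding a_def K_def distrib_right by linarith
    have "0 \<le> dirichlet_form G (\<lambda>x. h x - 1 / K * A x) (\<lambda>x. h x - 1 / K * A x)
        - l * dot G (\<lambda>x. h x - 1 / K * A x) (\<lambda>x. h x - 1 / K * A x)"
      using rayleigh_inf_le[OF G(1)] by (simp add: l_def)
    also have "\<dots> = X - 2 / K * (dirichlet_form G A h - l * dot G A h)
        + (1 / K)\<^sup>2 * (dirichlet_form G A A - l * dot G A A)"
      unfolding dirichlet_form_diff dot_diff X_def by (simp add: algebra_simps diff_divide_distrib)
    also have "\<dots> \<le> X - 2 / K * a + (1 / K)\<^sup>2 * (K * a)"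
      unfolding Ah using AA by (intro add_left_mono mult_left_mono) auto
    also have "\<dots> = X - a / K"
      using K by (simp add: power2_eq_square)
    finally have aX: "a \<le> K * X" using K by (simp add: field_simps)
    have "ell2_norm \<mu> h \<le> C * ell2_norm \<mu> A"
      using C[OF ell2_finite_support(1)[OF G(1), of A]] AG RA[OF ell2_finite_support(1)[OF G(1), of h]] hG
      by (simp add: A_def[abs_def])
    also have "\<dots> \<le> (\<bar>C\<bar> + 1) * ell2_norm \<mu> A"
      by (intro mult_right_mono ell2_norm_nonneg) simp
    finally have "(ell2_norm \<mu> h)\<^sup>2 \<le> ((\<bar>C\<bar> + 1) * ell2_norm \<mu> A)\<^sup>2"
      by (intro power_mono ell2_norm_nonneg)
    then have "dot G h h \<le> (\<bar>C\<bar> + 1)\<^sup>2 * a"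
      using ell2_finite_support(2)[OF G(1), of A] ell2_finite_support(2)[OF G(1), of h] AG hG
      by (simp add: power_mult_distrib a_def)
    also have "\<dots> \<le> (\<bar>C\<bar> + 1)\<^sup>2 * (K * X)"
      using aX by (intro mult_left_mono) auto
    finally have "e * dot G h h \<le> X"
      using K unfolding e_def by (simp add: field_simps)
    moreover have "dot G h h = dot U f f"
      unfolding dot_def by (rule sum.mono_neutral_cong_right) (use G in \<open>auto simp: h_def\<close>)
    moreover have "dirichlet_form G h h = dirichlet_form U f f"
    proof -
      have "dot G h (\<Delta> h) = dot U h (\<Delta> h)"
        unfolding dot_def by (rule sum.mono_neutral_right) (use G in \<open>auto simp: h_def\<close>)
      then have "dirichlet_form G h h = dirichlet_form U h h"
        using dot_laplacian[OF G(1), of h h] dot_laplacian[OF U, of h h] hG by (simp add: h_def)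
      then show ?thesis by (simp add: dirichlet_form_def edge_form_def h_def)
    qed
    ultimately show ?thesis by (simp add: X_def algebra_simps)
  qed
  have "l + e \<le> Inf rayleigh_quotients"
    using gap by (intro cInf_greatest rayleigh_quotients_nonempty)
      (auto simp: rayleigh_quotients_def field_simps)
  then show False using e by (simp add: l_def)
qed

text \<open>
  The form in which the spectrum enters the heat kernel estimate. That the spectrum is bounded
  below makes its infimum a lower bound of its elements, in particular of the infimum of the
  Rayleigh quotients.
\<close>
lemma spectral_bottom_le:
  assumes "finite U"
  shows "\<Lambda> * dot U f f \<le> dirichlet_form U f f"
proof -
  have "\<Lambda> \<le> Inf rayleigh_quotients"
    unfolding spectral_bottom_def using spectrum_nonneg rayleigh_inf_in_spectrum
    by (intro cInf_lower bdd_belowI[of _ 0])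
  then show ?thesis
    using rayleigh_inf_le[OF assms, of f] dot_nonneg[of U f] by (meson mult_right_mono order_trans)
qed

section \<open>Exponentially weighted energy decay\<close>

text \<open>
  The left-hand side is the quadratic form of \<open>exp \<psi> \<circ> \<Delta> \<circ> exp (-\<psi>)\<close>. Exchanging the two ends of
  each edge replaces the exponential by the hyperbolic cosine, so the twist costs at most
  \<open>cosh a - 1\<close> times the degree, on top of the untwisted form.
\<close>
lemma twisted_form_le:
  assumes U: "finite U" and \<psi>: "\<And>x y. (x, y) \<in> E \<Longrightarrow> \<bar>\<psi> x - \<psi> y\<bar> \<le> a"
  shows "(\<Sum>x\<in>U. \<Sum>y\<in>U. W x y * (exp (\<psi> x - \<psi> y) * (f x * f y))) - (\<Sum>x\<in>U. deg x * (f x)\<^sup>2)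
    \<le> ((cosh a - 1) * D - \<Lambda>) * dot U f f"
proof -
  let ?S = "\<Sum>x\<in>U. \<Sum>y\<in>U. W x y * (exp (\<psi> x - \<psi> y) * (f x * f y))"
  have ch: "\<bar>cosh (\<psi> x - \<psi> y) - 1\<bar> \<le> cosh a - 1" if "(x, y) \<in> E" for x y
  proof -
    have "cosh \<bar>\<psi> x - \<psi> y\<bar> \<le> cosh a"
      using \<psi>[OF that] by (subst cosh_real_nonneg_le_iff) auto
    then show ?thesis using cosh_real_ge_1[of "\<psi> x - \<psi> y"] by simp
  qed
  have "?S = (\<Sum>x\<in>U. \<Sum>y\<in>U. W x y * (exp (- (\<psi> x - \<psi> y)) * (f x * f y)))"
    by (subst sum.swap) (simp add: W_sym mult_ac)
  then have "2 * ?S = (\<Sum>x\<in>U. \<Sum>y\<in>U. W x y * (exp (\<psi> x - \<psi> y) * (f x * f y)))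
     + (\<Sum>x\<in>U. \<Sum>y\<in>U. W x y * (exp (- (\<psi> x - \<psi> y)) * (f x * f y)))" by linarith
  also have "\<dots> = 2 * (edge_form U f f + (\<Sum>x\<in>U. \<Sum>y\<in>U. W x y * ((cosh (\<psi> x - \<psi> y) - 1) * (f x * f y))))"
    unfolding edge_form_def sum.distrib[symmetric] sum_distrib_left
    by (intro sum.cong refl) (simp add: cosh_field_def field_simps)
  finally have "?S = edge_form U f f + (\<Sum>x\<in>U. \<Sum>y\<in>U. W x y * ((cosh (\<psi> x - \<psi> y) - 1) * (f x * f y)))"
    by simp
  moreover have "\<bar>\<Sum>x\<in>U. \<Sum>y\<in>U. W x y * ((cosh (\<psi> x - \<psi> y) - 1) * (f x * f y))\<bar>
      \<le> (cosh a - 1) * (\<Sum>x\<in>U. deg x * (f x)\<^sup>2)"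
    using ch cosh_real_ge_1[of a] by (intro edge_sum_le U) auto
  moreover have "(cosh a - 1) * (\<Sum>x\<in>U. deg x * (f x)\<^sup>2) \<le> (cosh a - 1) * (D * dot U f f)"
    unfolding dot_def sum_distrib_left[of D] mult.assoc[symmetric, of D] power2_eq_square
    using deg_le cosh_real_ge_1[of a] by (intro mult_left_mono sum_mono mult_right_mono) auto
  ultimately show ?thesis
    using spectral_bottom_le[OF U, of f] by (simp add: dirichlet_form_def power2_eq_square algebra_simps)
qed

lemma dirichlet_laplacian_eq:
  assumes "finite U" "x \<in> U"
  shows "\<mu> x * dirichlet_laplacian E \<omega> \<mu> U f x = (\<Sum>y\<in>U. W x y * f y) - deg x * f x"
  using assms laplacian_eq_on[of U x "\<lambda>z. if z \<in> U then f z else 0"]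
  by (simp add: dirichlet_laplacian_def)

text \<open>
  The derivative of the weighted energy is twice the twisted form at \<open>exp \<psi> * u\<close>, which is at most
  a constant multiple of the energy, so Gronwall's argument applies. With \<open>\<psi> = 0\<close> this gives uniqueness for
  the heat equation on \<open>U\<close>, and with \<open>\<psi>\<close> a multiple of the distance the off-diagonal decay.
\<close>
lemma weighted_energy_decay:
  assumes U: "finite U" and \<psi>: "\<And>x y. (x, y) \<in> E \<Longrightarrow> \<bar>\<psi> x - \<psi> y\<bar> \<le> a"
    and u: "\<And>t x. x \<in> U \<Longrightarrow>
      ((\<lambda>t. u t x) has_real_derivative dirichlet_laplacian E \<omega> \<mu> U (u t) x) (at t)"
    and t: "0 \<le> t"
  shows "dot U (\<lambda>x. exp (\<psi> x) * u t x) (\<lambda>x. exp (\<psi> x) * u t x)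
    \<le> dot U (\<lambda>x. exp (\<psi> x) * u 0 x) (\<lambda>x. exp (\<psi> x) * u 0 x)
      * exp (2 * ((cosh a - 1) * D - \<Lambda>) * t)"
proof -
  define \<kappa> where "\<kappa> = (cosh a - 1) * D - \<Lambda>"
  define w where "w t x = exp (\<psi> x) * u t x" for t x
  define F where "F t = dot U (w t) (w t)" for t
  define F' where "F' t = (\<Sum>x\<in>U. 2 * (\<mu> x * (w t x * (exp (\<psi> x) * dirichlet_laplacian E \<omega> \<mu> U (u t) x))))" for t
  have F': "(F has_real_derivative F' t) (at t)" for t
    unfolding F_def[abs_def] F'_def dot_def w_def
    by (rule DERIV_sum) (auto intro!: derivative_eq_intros u simp: algebra_simps)
  have bound: "F' t \<le> 2 * \<kappa> * F t" for t
  proof -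
    have "w t x * (exp (\<psi> x) * (\<mu> x * dirichlet_laplacian E \<omega> \<mu> U (u t) x))
        = (\<Sum>y\<in>U. W x y * (exp (\<psi> x - \<psi> y) * (w t x * w t y))) - deg x * (w t x)\<^sup>2"
      if "x \<in> U" for x
      unfolding dirichlet_laplacian_eq[OF U that]
      by (simp add: w_def exp_diff right_diff_distrib sum_distrib_left power2_eq_square mult_ac)
    then have "F' t = 2 * ((\<Sum>x\<in>U. \<Sum>y\<in>U. W x y * (exp (\<psi> x - \<psi> y) * (w t x * w t y)))
        - (\<Sum>x\<in>U. deg x * (w t x)\<^sup>2))"
      unfolding F'_def sum_subtractf[symmetric] sum_distrib_left
      by (intro sum.cong) (simp_all add: mult_ac)
    also have "\<dots> \<le> 2 * (\<kappa> * F t)"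
      unfolding \<kappa>_def F_def
      using twisted_form_le[where f = "w t" and a = a and \<psi> = \<psi>, OF U \<psi>] by (intro mult_left_mono) auto
    finally show ?thesis by simp
  qed
  have "F t * exp (- 2 * \<kappa> * t) \<le> F 0 * exp (- 2 * \<kappa> * 0)"
  proof (rule DERIV_nonpos_imp_nonincreasing[OF t])
    fix r
    have "((\<lambda>t. F t * exp (- 2 * \<kappa> * t)) has_real_derivative
        (F' r - 2 * \<kappa> * F r) * exp (- 2 * \<kappa> * r)) (at r)"
      by (auto intro!: derivative_eq_intros F' simp: algebra_simps)
    moreover have "(F' r - 2 * \<kappa> * F r) * exp (- 2 * \<kappa> * r) \<le> 0"
      using bound[of r] by (simp add: mult_nonpos_nonneg)
    ultimately show "\<exists>y. ((\<lambda>t. F t * exp (- 2 * \<kappa> * t)) has_real_derivative y) (at r) \<and> y \<le> 0"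
      by blast
  qed
  then have "F t \<le> F 0 * exp (2 * \<kappa> * t)"
    by (simp add: exp_minus field_simps)
  then show ?thesis by (simp add: F_def w_def[abs_def] \<kappa>_def)
qed

section \<open>Dirichlet heat kernels\<close>

definition dirichlet_kernel :: "'v set \<Rightarrow> 'v \<Rightarrow> 'v \<Rightarrow> real" where
  "dirichlet_kernel U x y = (if x \<in> U then (W x y - (if x = y then deg x else 0)) / \<mu> x else 0)"

lemma dirichlet_laplacian_kernel:
  assumes "finite U"
  shows "dirichlet_laplacian E \<omega> \<mu> U = kernel_op U (dirichlet_kernel U)"
proof (intro ext)
  fix f x
  show "dirichlet_laplacian E \<omega> \<mu> U f x = kernel_op U (dirichlet_kernel U) f x"
  proof (cases "x \<in> U")
    case True
    have "(\<Sum>y\<in>U. (if x = y then deg x else 0) * f y) = deg x * f x"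
      using True assms by (simp add: if_distrib[of "\<lambda>c. c * _"] sum.delta cong: if_cong)
    then have "\<mu> x * kernel_op U (dirichlet_kernel U) f x = (\<Sum>y\<in>U. W x y * f y) - deg x * f x"
      using True measure_pos[of x]
      by (simp add: kernel_op_def dirichlet_kernel_def left_diff_distrib sum_subtractf
          flip: sum_divide_distrib)
    then show ?thesis
      using dirichlet_laplacian_eq[OF assms True, of f] measure_pos[of x] by (metis less_irrefl mult_left_cancel)
  qed (simp add: dirichlet_laplacian_def kernel_op_def dirichlet_kernel_def)
qed

lemma dirichlet_semigroup_kernel:
  "finite U \<Longrightarrow> dirichlet_semigroup E \<omega> \<mu> U t f x = kernel_exp U (dirichlet_kernel U) t f x"
  by (simp add: dirichlet_semigroup_def kernel_exp_def dirichlet_laplacian_kernel)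

lemma dirichlet_semigroup_has_derivative:
  assumes "finite U" "x \<in> U"
  shows "((\<lambda>t. dirichlet_semigroup E \<omega> \<mu> U t f x) has_real_derivative
           dirichlet_laplacian E \<omega> \<mu> U (dirichlet_semigroup E \<omega> \<mu> U t f) x) (at t)"
proof -
  have "dirichlet_semigroup E \<omega> \<mu> U t f = kernel_exp U (dirichlet_kernel U) t f" for t
    using assms dirichlet_semigroup_kernel by auto
  then show ?thesis
    using kernel_exp_has_derivative[OF assms] dirichlet_laplacian_kernel[OF assms(1)] by simp
qed

lemma dirichlet_semigroup_0: "dirichlet_semigroup E \<omega> \<mu> U 0 f x = f x"
  unfolding dirichlet_semigroup_def by (subst suminf_finite[where N = "{0}"]) auto

definition jump_kernel :: "'v set \<Rightarrow> 'v \<Rightarrow> 'v \<Rightarrow> real" where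
  "jump_kernel U x y = (if x \<in> U then jump x y / \<mu> x else 0)"

text \<open>
  Both sides solve the heat equation on \<open>U\<close> with initial value \<open>f\<close>, and the energy of their
  difference starts at zero. For nonnegative \<open>f\<close> the right-hand side displays the semigroup as
  a series with nonnegative terms.
\<close>
lemma dirichlet_semigroup_eq_jump:
  assumes U: "finite U" "x \<in> U" and t: "0 \<le> t"
  shows "dirichlet_semigroup E \<omega> \<mu> U t f x = exp (- D * t) * kernel_exp U (jump_kernel U) t f x"
proof -
  define v where "v t x = exp (- D * t) * kernel_exp U (jump_kernel U) t f x" for t x
  define u where "u t x = dirichlet_semigroup E \<omega> \<mu> U t f x - v t x" for t x
  have op: "kernel_op U (jump_kernel U) g z = dirichlet_laplacian E \<omega> \<mu> U g z + D * g z"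
    if z: "z \<in> U" for g z
  proof -
    have "jump_kernel U z y = dirichlet_kernel U z y + (if y = z then D else 0)" for y
      using z measure_pos[of z]
      by (simp add: jump_kernel_def dirichlet_kernel_def jump_def add_divide_distrib diff_divide_distrib)
    then have "kernel_op U (jump_kernel U) g z
        = (\<Sum>y\<in>U. dirichlet_kernel U z y * g y + (if y = z then D * g z else 0))"
      by (simp add: kernel_op_def distrib_right cong: if_cong) (auto intro!: sum.cong)
    then show ?thesis
      using z U by (simp add: sum.distrib dirichlet_laplacian_kernel kernel_op_def)
  qed
  have v: "((\<lambda>t. v t z) has_real_derivative dirichlet_laplacian E \<omega> \<mu> U (v t) z) (at t)"
    if z: "z \<in> U" for t z
  proof -
    have "((\<lambda>t. v t z) has_real_derivative
        - D * v t z + exp (- D * t) * kernel_op U (jump_kernel U) (kernel_exp U (jump_kernel U) t f) z) (at t)"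
      unfolding v_def
      by (auto intro!: derivative_eq_intros kernel_exp_has_derivative[OF U(1) z] simp: algebra_simps)
    moreover have "exp (- D * t) * kernel_op U (jump_kernel U) (kernel_exp U (jump_kernel U) t f) z
        = kernel_op U (jump_kernel U) (v t) z"
      by (simp add: kernel_op_def v_def sum_distrib_left mult_ac)
    ultimately show ?thesis using op[OF z, of "v t"] by simp
  qed
  have "((\<lambda>t. u t z) has_real_derivative dirichlet_laplacian E \<omega> \<mu> U (u t) z) (at t)"
    if z: "z \<in> U" for t z
  proof -
    have "dirichlet_laplacian E \<omega> \<mu> U (u t) z
      = dirichlet_laplacian E \<omega> \<mu> U (dirichlet_semigroup E \<omega> \<mu> U t f) z - dirichlet_laplacian E \<omega> \<mu> U (v t) z"
      using U by (simp add: dirichlet_laplacian_kernel kernel_op_def u_def right_diff_distrib sum_subtractf)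
    then show ?thesis
      unfolding u_def using DERIV_diff[OF dirichlet_semigroup_has_derivative[OF U(1) z] v[OF z]] by simp
  qed
  from weighted_energy_decay[where a = 0 and \<psi> = "\<lambda>_. 0", OF U(1) _ this t]
  have "dot U (u t) (u t) \<le> dot U (u 0) (u 0) * exp (2 * (- \<Lambda>) * t)" by simp
  also have "dot U (u 0) (u 0) = 0"
    by (simp add: dot_def u_def v_def dirichlet_semigroup_0 kernel_exp_0)
  finally have "dot U (u t) (u t) = 0" using dot_nonneg[of U "u t"] by simp
  moreover have "\<mu> x * (u t x * u t x) \<le> dot U (u t) (u t)"
    unfolding dot_def using U measure_pos
    by (intro member_le_sum[of x U "\<lambda>x. \<mu> x * (u t x * u t x)"]) (auto simp: less_imp_le)
  ultimately have "u t x * u t x \<le> 0"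
    using measure_pos[of x] by (simp add: mult_le_0_iff)
  then have "u t x = 0" by (metis mult_eq_0_iff order_antisym zero_le_square)
  then show ?thesis by (simp add: u_def v_def)
qed

lemma dirichlet_heat_kernel_nonneg:
  assumes "finite U" "0 \<le> t"
  shows "0 \<le> dirichlet_heat_kernel E \<omega> \<mu> U t x y"
proof -
  have "0 \<le> kernel_exp U (jump_kernel U) t (indicator {y}) x" if "x \<in> U"
    using assms that jump_nonneg measure_pos
    by (intro kernel_exp_nonneg) (auto simp: jump_kernel_def less_imp_le)
  then show ?thesis
    using measure_pos[of y] assms
    by (auto simp: dirichlet_heat_kernel_def dirichlet_semigroup_eq_jump)
qed

lemma dirichlet_heat_kernel_mono:
  assumes "finite V" "U \<subseteq> V" "0 \<le> t"
  shows "dirichlet_heat_kernel E \<omega> \<mu> U t x y \<le> dirichlet_heat_kernel E \<omega> \<mu> V t x y"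
proof (cases "x \<in> U \<and> y \<in> U")
  case True
  have "kernel_exp U (jump_kernel U) t (indicator {y}) x \<le> kernel_exp V (jump_kernel V) t (indicator {y}) x"
    using assms True jump_nonneg measure_pos
    by (intro kernel_exp_mono) (auto simp: jump_kernel_def less_imp_le)
  moreover have "finite U" using assms finite_subset by blast
  ultimately show ?thesis
    using True assms measure_pos[of y]
    by (auto simp: dirichlet_heat_kernel_def dirichlet_semigroup_eq_jump divide_right_mono)
next
  case False
  then have "dirichlet_heat_kernel E \<omega> \<mu> U t x y = 0" by (auto simp: dirichlet_heat_kernel_def)
  then show ?thesis using dirichlet_heat_kernel_nonneg[OF assms(1,3)] by simp
qed

lemma graph_dist_walk: "(x, y) \<in> E ^^ graph_dist E x y"
proof -
  obtain n where "(x, y) \<in> E ^^ n" using connected[of x y] rtrancl_imp_relpow by blast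
  then show ?thesis unfolding graph_dist_def by (rule LeastI)
qed

lemma graph_dist_edge:
  assumes "(x, y) \<in> E"
  shows "graph_dist E x z \<le> Suc (graph_dist E y z)"
proof -
  have "(x, z) \<in> E ^^ Suc (graph_dist E y z)"
    using assms graph_dist_walk by (rule relpow_Suc_I2)
  then show ?thesis unfolding graph_dist_def[of E x z] by (rule Least_le)
qed

lemma graph_dist_lipschitz:
  assumes "(x, y) \<in> E"
  shows "\<bar>real (graph_dist E x z) - real (graph_dist E y z)\<bar> \<le> 1"
proof -
  have "(y, x) \<in> E" using assms sym_edges by (rule symD[rotated])
  then show ?thesis
    using graph_dist_edge[OF assms, of z] graph_dist_edge[of y x z] by linarith
qed

lemma graph_dist_self: "graph_dist E x x = 0"
  unfolding graph_dist_def by (rule Least_eq_0) simp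

text \<open>
  The weight \<open>exp (a * dist (\<cdot>, y))\<close> is one at \<open>y\<close>, where the initial mass sits, and large at \<open>x\<close>;
  a single term of the weighted energy already bounds the kernel.
\<close>
lemma dirichlet_heat_kernel_le:
  assumes U: "finite U" and t: "0 \<le> t" and a: "0 \<le> a"
  shows "dirichlet_heat_kernel E \<omega> \<mu> U t x y \<le> (\<mu> x * \<mu> y) powr (- 1 / 2) *
    exp (- a * real (graph_dist E x y) + ((cosh a - 1) * D - \<Lambda>) * t)"
proof (cases "x \<in> U \<and> y \<in> U")
  case True
  define \<psi> where "\<psi> z = a * real (graph_dist E z y)" for z
  define \<kappa> where "\<kappa> = (cosh a - 1) * D - \<Lambda>"
  define u where "u t z = dirichlet_semigroup E \<omega> \<mu> U t (indicator {y}) z" for t z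
  have lip: "\<bar>\<psi> z - \<psi> z'\<bar> \<le> a" if "(z, z') \<in> E" for z z'
    using mult_left_mono[OF graph_dist_lipschitz[OF that, of y] a] a
    by (simp add: \<psi>_def abs_mult flip: right_diff_distrib)
  have "\<mu> x * (exp (\<psi> x) * u t x * (exp (\<psi> x) * u t x))
      \<le> dot U (\<lambda>x. exp (\<psi> x) * u t x) (\<lambda>x. exp (\<psi> x) * u t x)"
    unfolding dot_def using U True measure_pos
    by (intro member_le_sum[of x U "\<lambda>x. \<mu> x * (exp (\<psi> x) * u t x * (exp (\<psi> x) * u t x))"])
       (auto simp: less_imp_le)
  also have "\<dots> \<le> dot U (\<lambda>x. exp (\<psi> x) * u 0 x) (\<lambda>x. exp (\<psi> x) * u 0 x) * exp (2 * \<kappa> * t)"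
    unfolding \<kappa>_def
    by (rule weighted_energy_decay[OF U lip _ t])
       (use dirichlet_semigroup_has_derivative[OF U] in \<open>auto simp: u_def[abs_def]\<close>)
  also have "dot U (\<lambda>x. exp (\<psi> x) * u 0 x) (\<lambda>x. exp (\<psi> x) * u 0 x)
      = (\<Sum>z\<in>U. if z = y then \<mu> y else 0)"
    unfolding dot_def
    by (intro sum.cong) (auto simp: u_def dirichlet_semigroup_0 \<psi>_def graph_dist_self)
  also have "\<dots> = \<mu> y" using U True by simp
  finally have "\<mu> x * (exp (\<psi> x) * u t x)\<^sup>2 \<le> \<mu> y * (exp (\<kappa> * t))\<^sup>2"
    by (simp add: power2_eq_square mult_ac flip: exp_add)
  then have "sqrt (\<mu> x * (exp (\<psi> x) * u t x)\<^sup>2) \<le> sqrt (\<mu> y * (exp (\<kappa> * t))\<^sup>2)"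
    by (rule real_sqrt_le_mono)
  then have "sqrt (\<mu> x) * \<bar>exp (\<psi> x) * u t x\<bar> \<le> sqrt (\<mu> y) * exp (\<kappa> * t)"
    by (simp only: real_sqrt_mult real_sqrt_abs abs_exp_cancel)
  moreover have "sqrt (\<mu> x) * (exp (\<psi> x) * u t x) \<le> sqrt (\<mu> x) * \<bar>exp (\<psi> x) * u t x\<bar>"
    using measure_pos[of x] by (intro mult_left_mono) auto
  ultimately have "sqrt (\<mu> x) * (exp (\<psi> x) * u t x) \<le> sqrt (\<mu> y) * exp (\<kappa> * t)"
    by linarith
  then have "sqrt (\<mu> x) * u t x \<le> sqrt (\<mu> y) * (exp (\<kappa> * t) / exp (\<psi> x))"
    by (simp add: field_simps)
  then have "u t x / (sqrt (\<mu> y) * sqrt (\<mu> y))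
      \<le> 1 / (sqrt (\<mu> x) * sqrt (\<mu> y)) * (exp (\<kappa> * t) / exp (\<psi> x))"
    using measure_pos[of x] measure_pos[of y]
    by (simp add: field_simps del: real_sqrt_mult_self)
  then have "1 / \<mu> y * u t x \<le> 1 / (sqrt (\<mu> x) * sqrt (\<mu> y)) * (exp (\<kappa> * t) / exp (\<psi> x))"
    using measure_pos[of y] by simp
  also have "\<dots> = (\<mu> x * \<mu> y) powr (- 1 / 2) * exp (- a * real (graph_dist E x y) + \<kappa> * t)"
    using measure_pos[of x] measure_pos[of y]
    by (simp add: powr_minus_divide powr_half_sqrt real_sqrt_mult exp_diff \<psi>_def)
  finally show ?thesis using True by (simp add: dirichlet_heat_kernel_def u_def \<kappa>_def)
next
  case False
  then have "dirichlet_heat_kernel E \<omega> \<mu> U t x y = 0" by (auto simp: dirichlet_heat_kernel_def)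
  then show ?thesis by simp
qed

section \<open>The heat kernel of the graph\<close>

text \<open>
  Balls around one vertex are finite by local finiteness and exhaust the graph by connectedness.
\<close>
lemma exhaustion_exists: "\<exists>U. exhaustion (U :: nat \<Rightarrow> 'v set)"
proof -
  define S where "S n = {y. (undefined, y) \<in> E ^^ n}" for n
  have S: "finite (S n)" for n
  proof (induction n)
    case (Suc n)
    have "S (Suc n) = (\<Union>y\<in>S n. {z. (y, z) \<in> E})" by (auto simp: S_def)
    then show ?case using Suc locally_finite by simp
  qed (simp add: S_def)
  have "y \<in> (\<Union>k. \<Union>n\<le>k. S n)" for y
  proof -
    obtain n where "y \<in> S n"
      using connected[of undefined y] by (auto simp: S_def rtrancl_power)
    then show ?thesis by (intro UN_I[of n] UNIV_I) auto
  qed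
  then have "(\<Union>k. \<Union>n\<le>k. S n) = UNIV" by blast
  then have "exhaustion (\<lambda>k. \<Union>n\<le>k. S n)"
    using S unfolding exhaustion_def
    by (intro conjI allI UN_mono) auto
  then show ?thesis by blast
qed

text \<open>
  By monotonicity in the domain the limit along any exhaustion is the supremum over all finite
  sets, because every finite set is eventually contained in the exhaustion. The bound with \<open>a = 0\<close>
  shows that this supremum is finite.
\<close>
lemma heat_kernel_limit:
  assumes t: "0 \<le> t" and V: "exhaustion V"
  shows "(\<lambda>k. dirichlet_heat_kernel E \<omega> \<mu> (V k) t x y) \<longlonglongrightarrow> heat_kernel E \<omega> \<mu> t x y"
proof -
  let ?p = "\<lambda>U. dirichlet_heat_kernel E \<omega> \<mu> U t x y"
  define l where "l = (SUP U\<in>{U. finite U}. ?p U)"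
  have bdd: "bdd_above (?p ` {U. finite U})"
    using dirichlet_heat_kernel_le[of _ t 0 x y] t by (intro bdd_aboveI2) auto
  have lim: "(\<lambda>k. ?p (U k)) \<longlonglongrightarrow> l" if U: "exhaustion U" for U
  proof -
    have fin: "finite (U k)" for k using U by (simp add: exhaustion_def)
    have mono: "U j \<subseteq> U k" if "j \<le> k" for j k
      by (rule lift_Suc_mono_le[of U]) (use U that in \<open>auto simp: exhaustion_def\<close>)
    show ?thesis
    proof (rule increasing_tendsto)
      show "\<forall>\<^sub>F k in sequentially. ?p (U k) \<le> l"
        unfolding l_def using fin by (intro always_eventually allI cSUP_upper bdd) auto
    next
      fix r assume "r < l"
      then obtain A where A: "finite A" "r < ?p A"
        unfolding l_def using bdd by (subst (asm) less_cSUP_iff) auto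
      have "\<exists>k. A \<subseteq> U k"
        using A(1)
      proof induction
        case (insert z B)
        then obtain i where i: "B \<subseteq> U i" by blast
        have "z \<in> (\<Union>k. U k)" using U by (simp add: exhaustion_def)
        then obtain j where j: "z \<in> U j" by blast
        from i j mono[of i "max i j"] mono[of j "max i j"] show ?case by (intro exI[of _ "max i j"]) auto
      qed simp
      then obtain k where k: "A \<subseteq> U k" by blast
      have "r < ?p (U i)" if "k \<le> i" for i
        using A(2) dirichlet_heat_kernel_mono[OF fin[of i] order_trans[OF k mono[OF that]] t, of x y]
        by linarith
      then show "\<forall>\<^sub>F i in sequentially. r < ?p (U i)"
        by (auto simp: eventually_sequentially)
    qed
  qed
  have "heat_kernel E \<omega> \<mu> t x y = l"
    unfolding heat_kernel_def
  proof (rule the_equality)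
    fix l' assume l': "\<forall>U. exhaustion U \<longrightarrow> (\<lambda>k. ?p (U k)) \<longlonglongrightarrow> l'"
    show "l' = l" using LIMSEQ_unique lim[OF V] l' V by blast
  qed (use lim in blast)
  then show ?thesis using lim[OF V] by simp
qed

lemma heat_kernel_le:
  assumes "0 \<le> t" "0 \<le> a"
  shows "heat_kernel E \<omega> \<mu> t x y \<le> (\<mu> x * \<mu> y) powr (- 1 / 2) *
    exp (- a * real (graph_dist E x y) + ((cosh a - 1) * D - \<Lambda>) * t)"
proof -
  obtain U where U: "exhaustion (U :: nat \<Rightarrow> 'v set)" using exhaustion_exists by blast
  then have "finite (U k)" for k by (simp add: exhaustion_def)
  from dirichlet_heat_kernel_le[OF this assms] show ?thesis
    by (intro LIMSEQ_le_const2[OF heat_kernel_limit[OF assms(1) U]] exI[of _ 0] allI impI)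
qed

end

text \<open>
  For \<open>s < d\<close> the choice \<open>a = 1/2 * ln (d / s)\<close> makes \<open>-a * d\<close> equal to \<open>-d/2 * ln (d / s)\<close>, while
  \<open>(cosh a - 1) * s\<close> stays below \<open>d / 2\<close>; for \<open>d \<le> s\<close> the right-hand side is nonnegative and \<open>a = 0\<close>
  suffices. In the degenerate cases \<open>d = 0\<close> and \<open>s = 0\<close> the conventions \<open>x / 0 = 0\<close> and \<open>ln 0 = 0\<close>
  make the right-hand side zero.
\<close>
lemma exponent_choice:
  fixes d s :: real
  assumes d: "0 \<le> d" and s: "0 \<le> s"
  shows "\<exists>a\<ge>0. - a * d + (cosh a - 1) * s \<le> - (d / 2 * ln (d / (2 * s * exp 1)))"
proof (cases "d = 0 \<or> s = 0")
  case True
  then show ?thesis using d by (intro exI[of _ 0]) auto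
next
  case False
  then have pos: "0 < d" "0 < s" using d s by auto
  have rhs: "- (d / 2 * ln (d / (2 * s * exp 1))) = d / 2 * (ln 2 + 1 + ln s - ln d)"
    using pos by (simp add: ln_div ln_mult algebra_simps)
  show ?thesis
  proof (cases "d \<le> s")
    case True
    then have "ln d \<le> ln s" using pos by simp
    then have "0 \<le> d / 2 * (ln 2 + 1 + ln s - ln d)"
      using pos ln_ge_zero[of "2 :: real"] by (intro mult_nonneg_nonneg) linarith+
    then show ?thesis unfolding rhs by (intro exI[of _ 0]) simp
  next
    case False
    \<comment> \<open>\<open>q = exp (-a)\<close> for the chosen \<open>a\<close>\<close>
    define q where "q = sqrt (s / d)"
    have q: "0 < q" "q \<le> 1" using False pos by (auto simp: q_def)
    have sq: "s = d * q\<^sup>2" using pos by (simp add: q_def)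
    have lns: "ln s = ln d + 2 * ln q" unfolding sq using pos q by (simp add: ln_mult ln_realpow)
    have ch: "cosh (- ln q) = (q + 1 / q) / 2"
      using q by (simp add: cosh_field_def exp_minus field_simps)
    have "(cosh (- ln q) - 1) * s = d * (q * (1 - q)\<^sup>2 / 2)"
      unfolding ch sq using q by (simp add: field_simps power2_eq_square)
    also have "\<dots> \<le> d * (1 / 2)"
      using pos q mult_mono[of q 1 "(1 - q)\<^sup>2" 1] power_le_one[of "1 - q" 2]
      by (intro mult_left_mono) auto
    finally have "(cosh (- ln q) - 1) * s \<le> d / 2" by simp
    moreover have "d / 2 * (ln 2 + 1 + ln s - ln d) = d * ln 2 / 2 + d / 2 + - (- ln q) * d"
      unfolding lns by (simp add: algebra_simps)
    moreover have "0 \<le> d * ln 2" using pos by simp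
    ultimately have "- (- ln q) * d + (cosh (- ln q) - 1) * s \<le> d / 2 * (ln 2 + 1 + ln s - ln d)"
      by linarith
    then show ?thesis
      unfolding rhs using q by (intro exI[of _ "- ln q"]) auto
  qed
qed

theorem theorem3p1:
  fixes E :: "'v rel" and \<omega> :: "'v \<Rightarrow> 'v \<Rightarrow> real" and \<mu> :: "'v \<Rightarrow> real"
    and x1 x2 :: 'v and t :: real
  assumes "weighted_graph E \<omega> \<mu>"
    and "finite_D E \<omega> \<mu>"
    and "t > 0"
  shows "heat_kernel E \<omega> \<mu> t x1 x2
    \<le> (\<mu> x1 * \<mu> x2) powr (- 1 / 2) *
      exp (- (real (graph_dist E x1 x2) / 2 *
               ln (real (graph_dist E x1 x2) / (2 * D_sup E \<omega> \<mu> * exp 1 * t)))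
           - spectral_bottom E \<omega> \<mu> * t)"
proof -
  interpret weighted_graph E \<omega> \<mu> by fact
  interpret bounded_graph E \<omega> \<mu> by unfold_locales fact
  let ?d = "real (graph_dist E x1 x2)"
  obtain a where a: "0 \<le> a"
    "- a * ?d + (cosh a - 1) * (D * t) \<le> - (?d / 2 * ln (?d / (2 * (D * t) * exp 1)))"
    using exponent_choice[of ?d "D * t"] D_nonneg \<open>t > 0\<close> by auto
  have "heat_kernel E \<omega> \<mu> t x1 x2
      \<le> (\<mu> x1 * \<mu> x2) powr (- 1 / 2) * exp (- a * ?d + ((cosh a - 1) * D - \<Lambda>) * t)"
    using \<open>t > 0\<close> a(1) by (intro heat_kernel_le) auto
  also have "\<dots> \<le> (\<mu> x1 * \<mu> x2) powr (- 1 / 2) *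
      exp (- (?d / 2 * ln (?d / (2 * D * exp 1 * t))) - \<Lambda> * t)"
    using a(2) by (intro mult_left_mono) (auto simp: algebra_simps)
  finally show ?thesis .
qed

end
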